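(* The point symmetry pseudogroup $G$ of the (1+1)-dimensional linear heat equation $u_t=u_{xx}$ is constituted by the point transformations of the form $$\tilde t=\frac{\alpha t+\beta}{\gamma t+\delta},\qquad \tilde x=\frac{x+\lambda_1t+\lambda_0}{\gamma t+\delta},$$ $$\tilde u=\sigma\sqrt{|\gamma t+\delta|}\,\exp\!\left(\frac{\gamma (x+\lambda_1t+\lambda_0)^2}{4(\gamma t+\delta)}-\frac{\lambda_1}2x-\frac{\lambda_1^2}4t\right)\big(u+h(t,x)\big),$$ where $\alpha,\beta,\gamma,\delta,\lambda_1,\lambda_0,\sigma$ are arbitrary real constants with $\alpha\delta-\beta\gamma=1$ and $\sigma\neq0$, and $h$ is an arbitrary (smooth, locally defined) solution of $h_t=h_{xx}$.
   Context: A point transformation is a local diffeomorphism $(t,x,u)\mapsto(\tilde t,\tilde x,\tilde u)=(T(t,x,u),X(t,x,u),U(t,x,u))$ of $\mathbb R^3$. It is a point symmetry of the heat equation $u_t=u_{xx}$ if it maps (locally) graphs of solutions $u=f(t,x)$ to graphs of solutions of the same equation. The point symmetry pseudogroup $G$ is the collection of all such transformations. As usual for pseudogroups, the description is local: near each point of its domain, a point symmetry transformation has the displayed form for some values of the parameters, and, conversely, any transformation of the displayed form, considered on the set of $(t,x,u)$ with $(t,x)\in\operatorname{dom}h$ and $\gamma t+\delta\ne0$, is a point symmetry. *)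

theory Defs
  imports "HOL-Analysis.Analysis"
begin

(* C^k via iterated directional derivatives. Used on open sets only, where
   frechet_derivative depends just on the values of f near the point. *)
primrec Ck_on :: "nat \<Rightarrow> 'a set \<Rightarrow> ('a::real_normed_vector \<Rightarrow> 'b::real_normed_vector) \<Rightarrow> bool" where
  "Ck_on 0 S f \<longleftrightarrow> continuous_on S f"
| "Ck_on (Suc k) S f \<longleftrightarrow>
     (\<forall>p\<in>S. f differentiable (at p)) \<and>
     (\<forall>v. Ck_on k S (\<lambda>p. frechet_derivative f (at p) v))"

definition smooth_on :: "'a set \<Rightarrow> ('a::real_normed_vector \<Rightarrow> 'b::real_normed_vector) \<Rightarrow> bool" where
  "smooth_on S f \<longleftrightarrow> (\<forall>k. Ck_on k S f)"

definition heat_solution :: "(real \<times> real) set \<Rightarrow> (real \<times> real \<Rightarrow> real) \<Rightarrow> bool" where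
  "heat_solution D f \<longleftrightarrow> open D \<and> smooth_on D f \<and>
     (\<forall>(t, x)\<in>D. deriv (\<lambda>s. f (s, x)) t = (deriv ^^ 2) (\<lambda>y. f (t, y)) x)"

definition graph_over :: "(real \<times> real) set \<Rightarrow> (real \<times> real \<Rightarrow> real) \<Rightarrow> (real \<times> real \<times> real) set" where
  "graph_over D f = {(t, x, f (t, x)) |t x. (t, x) \<in> D}"

(* Local diffeomorphisms in the sense of pseudogroups: smooth diffeomorphisms
   between open subsets. *)
definition point_transformation ::
    "(real \<times> real \<times> real) set \<Rightarrow> (real \<times> real \<times> real \<Rightarrow> real \<times> real \<times> real) \<Rightarrow> bool" where
  "point_transformation \<Omega> \<Phi> \<longleftrightarrow> open \<Omega> \<and> smooth_on \<Omega> \<Phi> \<and> open (\<Phi> ` \<Omega>) \<and>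
     (\<exists>\<Psi>. smooth_on (\<Phi> ` \<Omega>) \<Psi> \<and> (\<forall>p\<in>\<Omega>. \<Psi> (\<Phi> p) = p))"

(* The image of a graph under a point transformation can have vertical tangent
   planes; the condition concerns exactly those images that are again graphs of
   smooth functions. As D ranges over all open sets, small pieces of graphs are
   covered, so the condition is local. *)
definition heat_point_symmetry ::
    "(real \<times> real \<times> real) set \<Rightarrow> (real \<times> real \<times> real \<Rightarrow> real \<times> real \<times> real) \<Rightarrow> bool" where
  "heat_point_symmetry \<Omega> \<Phi> \<longleftrightarrow> point_transformation \<Omega> \<Phi> \<and>
     (\<forall>D f E g. heat_solution D f \<and> graph_over D f \<subseteq> \<Omega> \<and>
        open E \<and> smooth_on E g \<and> \<Phi> ` graph_over D f = graph_over E g \<longrightarrow>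
        heat_solution E g)"

definition heat_symmetry_form ::
    "real \<Rightarrow> real \<Rightarrow> real \<Rightarrow> real \<Rightarrow> real \<Rightarrow> real \<Rightarrow> real \<Rightarrow> (real \<times> real \<Rightarrow> real) \<Rightarrow>
     real \<times> real \<times> real \<Rightarrow> real \<times> real \<times> real" where
  "heat_symmetry_form \<alpha> \<beta> \<gamma> \<delta> l1 l0 \<sigma> h = (\<lambda>(t, x, u).
     ((\<alpha> * t + \<beta>) / (\<gamma> * t + \<delta>),
      (x + l1 * t + l0) / (\<gamma> * t + \<delta>),
      \<sigma> * sqrt \<bar>\<gamma> * t + \<delta>\<bar> *
        exp (\<gamma> * (x + l1 * t + l0)\<^sup>2 / (4 * (\<gamma> * t + \<delta>)) - l1 / 2 * x - l1\<^sup>2 / 4 * t) *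
        (u + h (t, x))))"

end

theory Submission
  imports Defs
begin

text \<open>
Let \<open>\<Phi> = (T, X, U)\<close> be a point symmetry. The 2-jet of a heat solution at a point can be prescribed up to
the relation \<open>f\<^sub>t = f\<^sub>x\<^sub>x\<close>, and wherever \<open>(T, X)\<close> restricted to the graph of \<open>f\<close> has nonzero Jacobian the
inverse function theorem makes the image a graph again, so that the transformed equation holds for the
prescribed jet. Its dependence on \<open>f\<^sub>t\<^sub>t\<close> forces \<open>T\<^sub>x = T\<^sub>u = 0\<close>; its dependence on \<open>f\<^sub>t\<close> then forces
\<open>X\<^sub>u = 0\<close> and \<open>T\<^sub>t = X\<^sub>x\<^sup>2\<close>; and as a polynomial identity in \<open>f\<^sub>x\<close> it yields \<open>U\<^sub>u\<^sub>u = 0\<close> together with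
linear equations for \<open>U\<close>. Put \<open>m = 1 / X\<^sub>x\<close>. The compatibility conditions of these equations say that \<open>m\<close>,
\<open>T m\<close> and \<open>X m - x\<close> are affine functions of \<open>t\<close> alone, which gives \<open>T\<close> and \<open>X\<close>. The logarithmic derivatives
of \<open>U\<^sub>u\<close> are then those of the asserted multiplier, and \<open>U / U\<^sub>u - u\<close> is a heat solution.
The converse is a direct computation in the new variables.
\<close>

section \<open>Smooth functions and directional derivatives\<close>

text \<open>Why \<open>m\<close>: by T_t = X_x^2 it is T_t^(-1/2) with the sign of X_x, and m_tt = 0
  is the vanishing of the Schwarzian derivative of T. The functions m and T m are then solutions of
  y'' = 0 with Wronskian m^2 T_t = 1, and for m = \<gamma> t + \<delta>, T m = \<alpha> t + \<beta>
  this reads \<alpha> \<delta> - \<beta> \<gamma> = 1. So the normalisation of the parameters comes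
  out of the equations, and reflections in x are the case of negative \<gamma> t + \<delta>. The
  multiplier arises as in the Hopf-Cole transformation: with q = X_t / X_x one has (log U_u)_x =
  -q/2, and compatibility with the t-derivative is the Burgers equation q_t = q q_x, its diffusion
  term being zero because q_xx = 0. The hypothesis on \<Phi> concerns only images that are graphs,
  so a jet may be used only if the Jacobian of (T, X) along it is nonzero. This Jacobian is an
  affine function of f_x and f_t that is not identically zero, so enough jets remain.\<close>

definition pd :: "'a \<Rightarrow> ('a::real_normed_vector \<Rightarrow> 'b::real_normed_vector) \<Rightarrow> 'a \<Rightarrow> 'b" where
  "pd v f = (\<lambda>p. frechet_derivative f (at p) v)"

lemma pd_eqI: "(f has_derivative f') (at p) \<Longrightarrow> pd v f p = f' v"
  using frechet_derivative_at[of f f' p] by (simp add: pd_def)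

lemma has_derivative_pd: "f differentiable (at p) \<Longrightarrow> (f has_derivative (\<lambda>v. pd v f p)) (at p)"
  by (simp add: frechet_derivative_works pd_def)

lemma Ck_on_Suc_pd:
  "Ck_on (Suc k) S f \<longleftrightarrow> (\<forall>p\<in>S. f differentiable (at p)) \<and> (\<forall>v. Ck_on k S (pd v f))"
  by (simp add: pd_def)

lemma pd_cong:
  assumes "open S" "p \<in> S" "\<And>q. q \<in> S \<Longrightarrow> f q = g q"
  shows "pd v f p = pd v g p"
proof (cases "f differentiable (at p)")
  case True
  then have "(f has_derivative (\<lambda>v. pd v f p)) (at p)" by (rule has_derivative_pd)
  then have "(g has_derivative (\<lambda>v. pd v f p)) (at p)"
    using has_derivative_transform_within_open assms by blast
  from pd_eqI[OF this] show ?thesis by simp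
next
  case False
  have "\<not> g differentiable (at p)"
    by (metis False assms differentiable_def has_derivative_transform_within_open)
  \<comment> \<open>Without differentiability \<open>frechet_derivative\<close> is still a choice of
    some derivative; the two predicates chosen from coincide, hence so do the choices. The
    congruence therefore needs no side condition.\<close>
  moreover have "(f has_derivative D) (at p) \<longleftrightarrow> (g has_derivative D) (at p)" for D
    using assms by (metis has_derivative_transform_within_open)
  ultimately show ?thesis by (simp add: pd_def frechet_derivative_def)
qed

section \<open>Closure properties of the classes C^k\<close>

lemma Ck_on_cong:
  assumes "open S" "Ck_on k S f" "\<And>q. q \<in> S \<Longrightarrow> f q = g q"
  shows "Ck_on k S g"
  using assms
proof (induction k arbitrary: f g)
  case 0
  then show ?case by (metis Ck_on.simps(1) continuous_on_cong)
next
  case (Suc k)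
  have "g differentiable (at p)" if "p \<in> S" for p
    using Suc.prems that unfolding Ck_on.simps
    by (metis differentiable_def has_derivative_transform_within_open)
  moreover have "Ck_on k S (pd v g)" for v
    by (rule Suc.IH[of "pd v f"]) (use Suc.prems in \<open>auto simp: Ck_on_Suc_pd intro: pd_cong simp del: Ck_on.simps\<close>)
  ultimately show ?case by (simp add: Ck_on_Suc_pd del: Ck_on.simps)
qed

text \<open>The inductions over the order use this rule: the derivative is supplied as an explicit
  formula on S, and the congruence on open sets passes from the formula to
  \<open>pd\<close>.\<close>

lemma Ck_on_SucI:
  assumes "open S" "\<And>p. p \<in> S \<Longrightarrow> (f has_derivative f' p) (at p)"
    "\<And>v. Ck_on k S (\<lambda>p. f' p v)"
  shows "Ck_on (Suc k) S f"
proof -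
  have "Ck_on k S (pd v f)" for v
    by (rule Ck_on_cong[OF assms(1) assms(3)[of v]]) (simp add: pd_eqI[OF assms(2)])
  then show ?thesis
    using assms(2) by (auto simp: Ck_on_Suc_pd differentiable_def simp del: Ck_on.simps)
qed

lemma Ck_on_SucD:
  assumes "Ck_on (Suc k) S f"
  shows "\<And>p. p \<in> S \<Longrightarrow> (f has_derivative (\<lambda>v. pd v f p)) (at p)" "\<And>v. Ck_on k S (pd v f)"
  using assms has_derivative_pd by (auto simp: Ck_on_Suc_pd simp del: Ck_on.simps)

lemma Ck_on_pred: "Ck_on (Suc k) S f \<Longrightarrow> Ck_on k S f"
proof (induction k arbitrary: f)
  case 0
  then show ?case
    by (auto intro!: continuous_at_imp_continuous_on differentiable_imp_continuous_within)
qed (auto simp: Ck_on_Suc_pd simp del: Ck_on.simps)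

lemma Ck_on_subset: "Ck_on k S f \<Longrightarrow> T \<subseteq> S \<Longrightarrow> Ck_on k T f"
proof (induction k arbitrary: f)
  case 0
  then show ?case by (auto intro: continuous_on_subset)
qed (auto simp: Ck_on_Suc_pd simp del: Ck_on.simps)

lemma Ck_on_const: "open S \<Longrightarrow> Ck_on k S (\<lambda>p. c)"
proof (induction k arbitrary: c)
  case (Suc k)
  show ?case
    by (rule Ck_on_SucI[where f' = "\<lambda>p v. 0"]) (use Suc in \<open>auto intro: derivative_intros\<close>)
qed auto

lemma Ck_on_add:
  assumes "open S" "Ck_on k S f" "Ck_on k S g"
  shows "Ck_on k S (\<lambda>p. f p + g p)"
  using assms(2,3)
proof (induction k arbitrary: f g)
  case (Suc k)
  note f = Ck_on_SucD[OF Suc.prems(1)] and g = Ck_on_SucD[OF Suc.prems(2)]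
  show ?case
    by (rule Ck_on_SucI[OF assms(1) has_derivative_add[OF f(1) g(1)]]) (auto intro: Suc.IH f g)
qed (auto intro: continuous_intros)

lemma (in bounded_linear) Ck_on:
  assumes "open S" "Ck_on k S g"
  shows "Ck_on k S (\<lambda>p. f (g p))"
  using assms(2)
proof (induction k arbitrary: g)
  case (Suc k)
  note g = Ck_on_SucD[OF Suc.prems(1)]
  show ?case
    by (rule Ck_on_SucI[OF assms(1) has_derivative[OF g(1)]]) (auto intro: Suc.IH g)
qed (auto intro: continuous_on)

lemma (in bounded_bilinear) Ck_on:
  assumes "open S" "Ck_on k S f" "Ck_on k S g"
  shows "Ck_on k S (\<lambda>p. prod (f p) (g p))"
  using assms(2,3)
proof (induction k arbitrary: f g)
  case (Suc k)
  note f = Ck_on_SucD[OF Suc.prems(1)] and g = Ck_on_SucD[OF Suc.prems(2)]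
  show ?case
    by (rule Ck_on_SucI[OF assms(1) FDERIV[OF f(1) g(1)]])
      (auto intro!: Ck_on_add assms(1) Suc.IH f g Ck_on_pred[OF Suc.prems(1)] Ck_on_pred[OF Suc.prems(2)])
qed (auto intro: continuous_on)

lemma Ck_on_sum:
  assumes "open S" "finite I" "\<And>i. i \<in> I \<Longrightarrow> Ck_on k S (f i)"
  shows "Ck_on k S (\<lambda>p. \<Sum>i\<in>I. f i p)"
  using assms(2,3) by (induction I) (auto intro: Ck_on_const Ck_on_add assms(1))

text \<open>The chain rule differentiates f in the direction \<open>pd v g p\<close>, which varies
  with p, whereas \<open>Ck_on\<close> concerns fixed directions. Expanding the direction in a
  finite basis turns the derivative into a sum of products to which the induction hypothesis
  applies.\<close>

lemma Ck_on_compose: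
  fixes f :: "'b::euclidean_space \<Rightarrow> 'c::real_normed_vector"
    and g :: "'a::real_normed_vector \<Rightarrow> 'b"
  assumes "open S" "open T" "Ck_on k T f" "Ck_on k S g" "\<And>p. p \<in> S \<Longrightarrow> g p \<in> T"
  shows "Ck_on k S (\<lambda>p. f (g p))"
  using assms(3,4)
proof (induction k arbitrary: f)
  case 0
  then show ?case using assms(5) by (auto intro!: continuous_on_compose2[of T f S g])
next
  case (Suc k)
  note f = Ck_on_SucD[OF Suc.prems(1)] and g = Ck_on_SucD[OF Suc.prems(2)]
  show ?case
  proof (rule Ck_on_SucI[OF assms(1)])
    fix p assume p: "p \<in> S"
    note h = has_derivative_compose[OF g(1)[OF p] f(1)[OF assms(5)[OF p]]]
    have lin: "linear (\<lambda>v. pd v f (g p))"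
      using f(1)[OF assms(5)[OF p]] by (rule has_derivative_linear)
    have "pd w f (g p) = (\<Sum>b\<in>Basis. (w \<bullet> b) *\<^sub>R pd b f (g p))" for w
    proof -
      have "pd w f (g p) = pd (\<Sum>b\<in>Basis. (w \<bullet> b) *\<^sub>R b) f (g p)"
        by (simp only: euclidean_representation)
      also have "\<dots> = (\<Sum>b\<in>Basis. pd ((w \<bullet> b) *\<^sub>R b) f (g p))"
        by (rule linear_sum[OF lin])
      also have "\<dots> = (\<Sum>b\<in>Basis. (w \<bullet> b) *\<^sub>R pd b f (g p))"
        by (intro sum.cong refl linear_scale[OF lin])
      finally show ?thesis .
    qed
    then have "(\<lambda>x. pd (pd x g p) f (g p)) = (\<lambda>v. \<Sum>b\<in>Basis. (pd v g p \<bullet> b) *\<^sub>R pd b f (g p))"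
      by (intro ext)
    with h show "((\<lambda>p. f (g p)) has_derivative
        (\<lambda>v. \<Sum>b\<in>Basis. (pd v g p \<bullet> b) *\<^sub>R pd b f (g p))) (at p)" by simp
  next
    fix v
    have "Ck_on k S (\<lambda>p. pd b f (g p))" for b
      by (rule Suc.IH[OF f(2) Ck_on_pred[OF Suc.prems(2)]])
    then show "Ck_on k S (\<lambda>p. \<Sum>b\<in>Basis. (pd v g p \<bullet> b) *\<^sub>R pd b f (g p))"
      by (intro Ck_on_sum assms(1) finite_Basis bounded_bilinear.Ck_on[OF bounded_bilinear_scaleR]
          bounded_linear.Ck_on[OF bounded_linear_inner_left] g)
  qed
qed

lemma Ck_on_inverse:
  fixes f :: "'a::real_normed_vector \<Rightarrow> real"
  assumes "open S" "Ck_on k S f" "\<And>p. p \<in> S \<Longrightarrow> f p \<noteq> 0"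
  shows "Ck_on k S (\<lambda>p. inverse (f p))"
  using assms(2)
proof (induction k)
  case (Suc k)
  note f = Ck_on_SucD[OF Suc.prems(1)]
  have i: "Ck_on k S (\<lambda>p. inverse (f p))" by (rule Suc.IH[OF Ck_on_pred[OF Suc.prems]])
  show ?case
  proof (rule Ck_on_SucI[OF assms(1)])
    show "((\<lambda>p. inverse (f p)) has_derivative (\<lambda>v. (-1) * (inverse (f p) * pd v f p * inverse (f p)))) (at p)"
      if "p \<in> S" for p
      using Deriv.has_derivative_inverse[OF assms(3)[OF that] f(1)[OF that]] by simp
    show "Ck_on k S (\<lambda>p. (-1) * (inverse (f p) * pd v f p * inverse (f p)))" for v
      by (intro bounded_bilinear.Ck_on[OF bounded_bilinear_mult] assms(1) i f Ck_on_const)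
  qed
qed (use assms(3) in \<open>auto intro!: continuous_intros\<close>)

section \<open>Closure properties of smooth functions\<close>

lemma smooth_on_cong:
  "open S \<Longrightarrow> smooth_on S f \<Longrightarrow> (\<And>q. q \<in> S \<Longrightarrow> f q = g q) \<Longrightarrow> smooth_on S g"
  unfolding smooth_on_def using Ck_on_cong by blast

lemma smooth_on_subset: "smooth_on S f \<Longrightarrow> T \<subseteq> S \<Longrightarrow> smooth_on T f"
  unfolding smooth_on_def using Ck_on_subset by blast

lemma smooth_on_const: "open S \<Longrightarrow> smooth_on S (\<lambda>p. c)"
  by (simp add: smooth_on_def Ck_on_const)

lemma smooth_on_pd: "smooth_on S f \<Longrightarrow> smooth_on S (pd v f)"
  unfolding smooth_on_def by (meson Ck_on_SucD(2))

lemma smooth_on_differentiable: "smooth_on S f \<Longrightarrow> p \<in> S \<Longrightarrow> f differentiable (at p)"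
  unfolding smooth_on_def by (metis Ck_on.simps(2))

lemma smooth_on_has_derivative:
  "smooth_on S f \<Longrightarrow> p \<in> S \<Longrightarrow> (f has_derivative (\<lambda>v. pd v f p)) (at p)"
  by (simp add: smooth_on_differentiable has_derivative_pd)

lemma smooth_on_continuous_on: "smooth_on S f \<Longrightarrow> continuous_on S f"
  unfolding smooth_on_def by (metis Ck_on.simps(1))

lemma smooth_on_compose:
  fixes f :: "'b::euclidean_space \<Rightarrow> 'c::real_normed_vector"
  assumes "open S" "open T" "smooth_on T f" "smooth_on S g" "\<And>p. p \<in> S \<Longrightarrow> g p \<in> T"
  shows "smooth_on S (\<lambda>p. f (g p))"
  using assms Ck_on_compose unfolding smooth_on_def by blast

lemma smooth_on_bounded_linear:
  "bounded_linear L \<Longrightarrow> open S \<Longrightarrow> smooth_on S f \<Longrightarrow> smooth_on S (\<lambda>p. L (f p))"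
  unfolding smooth_on_def using bounded_linear.Ck_on by blast

lemma smooth_on_ident: "open S \<Longrightarrow> smooth_on S (\<lambda>p. p)"
proof -
  assume S: "open S"
  have "Ck_on k S (\<lambda>p. p)" for k
  proof (cases k)
    case (Suc n)
    show ?thesis unfolding Suc
      by (rule Ck_on_SucI[OF S has_derivative_ident]) (rule Ck_on_const[OF S])
  qed simp
  then show ?thesis by (simp add: smooth_on_def)
qed

lemma smooth_on_add:
  "open S \<Longrightarrow> smooth_on S f \<Longrightarrow> smooth_on S g \<Longrightarrow> smooth_on S (\<lambda>p. f p + g p)"
  by (simp add: smooth_on_def Ck_on_add)

lemma smooth_on_mult:
  fixes f :: "'a::real_normed_vector \<Rightarrow> real"
  shows "open S \<Longrightarrow> smooth_on S f \<Longrightarrow> smooth_on S g \<Longrightarrow> smooth_on S (\<lambda>p. f p * g p)"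
  by (simp add: smooth_on_def bounded_bilinear.Ck_on[OF bounded_bilinear_mult])

lemma smooth_on_diff:
  fixes f :: "'a::real_normed_vector \<Rightarrow> 'b::real_normed_vector"
  assumes "open S" "smooth_on S f" "smooth_on S g"
  shows "smooth_on S (\<lambda>p. f p - g p)"
  using smooth_on_add[OF assms(1,2) smooth_on_bounded_linear[OF bounded_linear_minus[OF bounded_linear_ident] assms(1,3)]]
  by simp

lemma smooth_on_power:
  fixes f :: "'a::real_normed_vector \<Rightarrow> real"
  shows "open S \<Longrightarrow> smooth_on S f \<Longrightarrow> smooth_on S (\<lambda>p. f p ^ n)"
  by (induction n) (auto intro: smooth_on_const smooth_on_mult)

lemma smooth_on_divide:
  fixes f :: "'a::real_normed_vector \<Rightarrow> real"
  assumes "open S" "smooth_on S f" "smooth_on S g" "\<And>p. p \<in> S \<Longrightarrow> g p \<noteq> 0"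
  shows "smooth_on S (\<lambda>p. f p / g p)"
proof -
  have "smooth_on S (\<lambda>p. inverse (g p))"
    using assms by (simp add: smooth_on_def Ck_on_inverse)
  from smooth_on_mult[OF assms(1,2) this] show ?thesis by (simp add: divide_inverse)
qed

lemma smooth_on_Pair:
  fixes f :: "'a::real_normed_vector \<Rightarrow> 'b::real_normed_vector" and g :: "'a \<Rightarrow> 'c::real_normed_vector"
  assumes "open S" "smooth_on S f" "smooth_on S g"
  shows "smooth_on S (\<lambda>p. (f p, g p))"
proof -
  have 1: "bounded_linear (\<lambda>x. (x, 0) :: 'b \<times> 'c)" and 2: "bounded_linear (\<lambda>x. (0, x) :: 'b \<times> 'c)"
    by (intro bounded_linear_Pair bounded_linear_ident bounded_linear_zero)+
  show ?thesis
    using smooth_on_add[OF assms(1) smooth_on_bounded_linear[OF 1 assms(1,2)]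
        smooth_on_bounded_linear[OF 2 assms(1,3)]] by simp
qed

lemma smooth_on_fst: "open S \<Longrightarrow> smooth_on S f \<Longrightarrow> smooth_on S (\<lambda>p. fst (f p))"
  and smooth_on_snd: "open S \<Longrightarrow> smooth_on S f \<Longrightarrow> smooth_on S (\<lambda>p. snd (f p))"
  by (rule smooth_on_bounded_linear[OF bounded_linear_fst] smooth_on_bounded_linear[OF bounded_linear_snd]; assumption)+

lemmas smooth_on_intros = smooth_on_const smooth_on_ident smooth_on_add smooth_on_diff smooth_on_mult
  smooth_on_power smooth_on_divide smooth_on_Pair smooth_on_fst smooth_on_snd smooth_on_pd

text \<open>The derivative is the function itself times a smooth factor, so the induction over the
  order closes.\<close>

lemma smooth_on_exp:
  fixes f :: "'a::real_normed_vector \<Rightarrow> real"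
  assumes "open S" "smooth_on S f"
  shows "smooth_on S (\<lambda>p. exp (f p))"
proof -
  have "Ck_on k S (\<lambda>p. exp (f p))" for k
  proof (induction k)
    case 0
    show ?case using smooth_on_continuous_on[OF assms(2)] by (auto intro: continuous_intros)
  next
    case (Suc k)
    have "Ck_on k S (pd v f)" for v using smooth_on_pd[OF assms(2)] by (simp add: smooth_on_def)
    then have "Ck_on k S (\<lambda>p. exp (f p) * pd v f p)" for v
      by (intro assms(1) bounded_bilinear.Ck_on[OF bounded_bilinear_mult] Suc.IH)
    moreover have "((\<lambda>p. exp (f p)) has_derivative (\<lambda>v. exp (f p) * pd v f p)) (at p)" if "p \<in> S" for p
      using has_derivative_exp[OF smooth_on_has_derivative[OF assms(2) that]] by (simp add: mult_ac)
    ultimately show ?case by (intro Ck_on_SucI[where f' = "\<lambda>p v. exp (f p) * pd v f p"] assms(1))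
  qed
  then show ?thesis by (simp add: smooth_on_def)
qed

text \<open>Dividing by 2x instead of by 2 sqrt |x| gives one formula for both signs and displays
  the derivative as a multiple of the function, which is what the induction for smoothness
  uses.\<close>

lemma DERIV_sqrt_abs:
  fixes x :: real
  assumes "x \<noteq> 0"
  shows "((\<lambda>x. sqrt \<bar>x\<bar>) has_real_derivative sqrt \<bar>x\<bar> / (2 * x)) (at x)"
proof (cases "x > 0")
  case True
  then have "(sqrt has_real_derivative sqrt x / (2 * x)) (at x)"
  proof -
    have "inverse (sqrt x) / 2 = sqrt x / (2 * x)"
      using real_sqrt_mult_self[of x] True by (simp add: divide_simps)
    then show ?thesis using DERIV_real_sqrt[OF True] by metis
  qed
  then have "((\<lambda>x. sqrt \<bar>x\<bar>) has_real_derivative sqrt x / (2 * x)) (at x)"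
    by (rule has_field_derivative_transform_within_open[where S = "{0<..}"]) (use True in auto)
  then show ?thesis using True by simp
next
  case False
  then have x: "x < 0" using assms by simp
  have d: "((\<lambda>x. sqrt (-x)) has_real_derivative inverse (sqrt (-x)) / 2 * (-1)) (at x)"
    by (rule DERIV_chain2[OF DERIV_real_sqrt]) (use x in \<open>auto intro!: derivative_eq_intros\<close>)
  have "((\<lambda>x. sqrt (-x)) has_real_derivative sqrt (-x) / (2 * x)) (at x)"
  proof -
    have "inverse (sqrt (-x)) / 2 * (-1) = sqrt (-x) / (2 * x)"
      using real_sqrt_mult_self[of "-x"] x by (simp add: divide_simps)
    with d show ?thesis by metis
  qed
  then have "((\<lambda>x. sqrt \<bar>x\<bar>) has_real_derivative sqrt (-x) / (2 * x)) (at x)"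
    by (rule has_field_derivative_transform_within_open[where S = "{..<0}"]) (use x in auto)
  then show ?thesis using x by simp
qed

lemma has_derivative_sqrt_abs:
  fixes f :: "'a::real_normed_vector \<Rightarrow> real"
  assumes "(f has_derivative f') (at p)" "f p \<noteq> 0"
  shows "((\<lambda>p. sqrt \<bar>f p\<bar>) has_derivative (\<lambda>v. sqrt \<bar>f p\<bar> * (f' v / (2 * f p)))) (at p)"
  using has_derivative_compose[OF assms(1) DERIV_sqrt_abs[OF assms(2), unfolded has_field_derivative_def]]
  by (simp add: mult_ac)

lemma smooth_on_sqrt_abs:
  fixes f :: "'a::real_normed_vector \<Rightarrow> real"
  assumes "open S" "smooth_on S f" "\<And>p. p \<in> S \<Longrightarrow> f p \<noteq> 0"
  shows "smooth_on S (\<lambda>p. sqrt \<bar>f p\<bar>)"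
proof -
  have "Ck_on k S (\<lambda>p. sqrt \<bar>f p\<bar>)" for k
  proof (induction k)
    case 0
    show ?case using smooth_on_continuous_on[OF assms(2)] by (auto intro: continuous_intros)
  next
    case (Suc k)
    have "smooth_on S (\<lambda>p. pd v f p / (2 * f p))" for v
      by (intro smooth_on_intros assms) (use assms(3) in auto)
    then have "Ck_on k S (\<lambda>p. pd v f p / (2 * f p))" for v by (simp add: smooth_on_def)
    then show ?case
      by (intro Ck_on_SucI[where f' = "\<lambda>p v. sqrt \<bar>f p\<bar> * (pd v f p / (2 * f p))"] assms(1)
          has_derivative_sqrt_abs smooth_on_has_derivative[OF assms(2)] assms(3)
          bounded_bilinear.Ck_on[OF bounded_bilinear_mult] Suc.IH)
  qed
  then show ?thesis by (simp add: smooth_on_def)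
qed

section \<open>Symmetry of mixed second derivatives\<close>

lemma second_difference_mvt:
  fixes f :: "'a::real_normed_vector \<Rightarrow> real"
  assumes "open S" "smooth_on S f" "h > 0"
    and S: "\<And>s r. 0 \<le> s \<Longrightarrow> s \<le> h \<Longrightarrow> 0 \<le> r \<Longrightarrow> r \<le> h \<Longrightarrow> p + s *\<^sub>R v + r *\<^sub>R w \<in> S"
  shows "\<exists>s r. 0 < s \<and> s < h \<and> 0 < r \<and> r < h \<and>
    f (p + h *\<^sub>R v + h *\<^sub>R w) - f (p + h *\<^sub>R v) - f (p + h *\<^sub>R w) + f p =
    h * h * pd w (pd v f) (p + s *\<^sub>R v + r *\<^sub>R w)"
proof -
  have dv: "((\<lambda>s. f (p + s *\<^sub>R v + r *\<^sub>R w)) has_real_derivative pd v f (p + s *\<^sub>R v + r *\<^sub>R w)) (at s)"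
    if "0 \<le> s" "s \<le> h" "0 \<le> r" "r \<le> h" for s r
  proof -
    have 1: "((\<lambda>s. p + s *\<^sub>R v + r *\<^sub>R w) has_derivative (\<lambda>k. k *\<^sub>R v)) (at s)"
      by (auto intro!: derivative_eq_intros)
    note f = smooth_on_has_derivative[OF assms(2) S[OF that]]
    have "pd (k *\<^sub>R v) f (p + s *\<^sub>R v + r *\<^sub>R w) = pd v f (p + s *\<^sub>R v + r *\<^sub>R w) * k" for k
      using linear_scale[OF has_derivative_linear[OF f]] by simp
    then show ?thesis
      using has_derivative_compose[OF 1 f] by (simp add: has_field_derivative_def)
  qed
  \<comment> \<open>The mean value theorem is applied to this difference in s, and then to
    \<open>pd v f\<close> in r. The summand \<open>0 *\<^sub>R w\<close> keeps both ends in the form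
    with parameters s and r.\<close>
  define G where "G s = f (p + s *\<^sub>R v + h *\<^sub>R w) - f (p + s *\<^sub>R v + 0 *\<^sub>R w)" for s
  define G' where "G' s = pd v f (p + s *\<^sub>R v + h *\<^sub>R w) - pd v f (p + s *\<^sub>R v + 0 *\<^sub>R w)" for s
  have "(G has_real_derivative G' s) (at s)" if "0 \<le> s" "s \<le> h" for s
    unfolding G_def G'_def by (intro DERIV_diff dv) (use that assms(3) in auto)
  from MVT2[OF assms(3) this] obtain s where s: "0 < s" "s < h" "G h - G 0 = h * G' s" by auto
  have "((\<lambda>r. pd v f (p + s *\<^sub>R v + r *\<^sub>R w)) has_real_derivative pd w (pd v f) (p + s *\<^sub>R v + r *\<^sub>R w)) (at r)"
    if "0 \<le> r" "r \<le> h" for r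
  proof -
    have 1: "((\<lambda>r. p + s *\<^sub>R v + r *\<^sub>R w) has_derivative (\<lambda>k. k *\<^sub>R w)) (at r)"
      by (auto intro!: derivative_eq_intros)
    have "p + s *\<^sub>R v + r *\<^sub>R w \<in> S" using s that by (intro S) auto
    note f = smooth_on_has_derivative[OF smooth_on_pd[OF assms(2)] this, of v]
    have "pd (k *\<^sub>R w) (pd v f) (p + s *\<^sub>R v + r *\<^sub>R w) = pd w (pd v f) (p + s *\<^sub>R v + r *\<^sub>R w) * k" for k
      using linear_scale[OF has_derivative_linear[OF f]] by simp
    then show ?thesis
      using has_derivative_compose[OF 1 f] by (simp add: has_field_derivative_def)
  qed
  from MVT2[OF assms(3) this] obtain r where r: "0 < r" "r < h"
    "G' s = h * pd w (pd v f) (p + s *\<^sub>R v + r *\<^sub>R w)" by (auto simp: G'_def)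
  show ?thesis
    by (rule exI[of _ s], rule exI[of _ r]) (use s r in \<open>auto simp: G_def algebra_simps\<close>)
qed

text \<open>The second difference is symmetric in v and w, so the two mixed derivatives agree at two
  points as close to p as desired; their continuity excludes different values at p.\<close>

lemma pd_commute:
  fixes f :: "'a::real_normed_vector \<Rightarrow> real"
  assumes "open S" "smooth_on S f" "p \<in> S"
  shows "pd v (pd w f) p = pd w (pd v f) p"
proof (rule ccontr)
  define K where "K = pd w (pd v f)"
  define L where "L = pd v (pd w f)"
  assume "pd v (pd w f) p \<noteq> pd w (pd v f) p"
  then have e: "\<bar>K p - L p\<bar> / 2 > 0" by (simp add: K_def L_def)
  have "isCont K p" "isCont L p"
    unfolding K_def L_def using smooth_on_continuous_on[OF smooth_on_pd[OF smooth_on_pd[OF assms(2)]]] assms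
    by (auto simp: continuous_on_eq_continuous_at)
  then obtain d1 d2 where d: "d1 > 0" "\<And>q. dist q p < d1 \<Longrightarrow> dist (K q) (K p) < \<bar>K p - L p\<bar> / 2"
      "d2 > 0" "\<And>q. dist q p < d2 \<Longrightarrow> dist (L q) (L p) < \<bar>K p - L p\<bar> / 2"
    using e unfolding continuous_at_eps_delta by metis
  obtain d3 where d3: "d3 > 0" "ball p d3 \<subseteq> S" using assms openE by blast
  define d where "d = min d1 (min d2 d3)"
  have d0: "d > 0" using d d3 by (simp add: d_def)
  \<comment> \<open>This makes h (|v| + |w| + 1) equal to d / 2, so the whole parallelogram stays
    within distance d; the 1 covers v = w = 0.\<close>
  define h where "h = d / (2 * (norm v + norm w + 1))"
  have N: "norm v + norm w + 1 > 0" by (smt (verit) norm_ge_zero)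
  then have h: "h > 0" using d0 by (simp add: h_def)
  have hd: "h * (norm v + norm w + 1) < d"
  proof -
    have "h * (norm v + norm w + 1) = d / 2" using N by (simp add: h_def divide_simps)
    then show ?thesis using d0 by simp
  qed
  have near: "dist (p + s *\<^sub>R v + r *\<^sub>R w) p < d" if "0 \<le> s" "s \<le> h" "0 \<le> r" "r \<le> h" for s r
  proof -
    have "dist (p + s *\<^sub>R v + r *\<^sub>R w) p \<le> s * norm v + r * norm w"
      using norm_triangle_ineq[of "s *\<^sub>R v" "r *\<^sub>R w"] that by (simp add: dist_norm algebra_simps)
    also have "\<dots> \<le> h * norm v + h * norm w" using that by (intro add_mono mult_right_mono) auto
    also have "\<dots> \<le> h * (norm v + norm w + 1)" using h by (simp add: algebra_simps)
    finally show ?thesis using hd by simp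
  qed
  have S: "p + s *\<^sub>R v + r *\<^sub>R w \<in> S" if "0 \<le> s" "s \<le> h" "0 \<le> r" "r \<le> h" for s r
    using near[OF that] d3 by (auto simp: d_def dist_commute subset_iff)
  have S': "p + s *\<^sub>R w + r *\<^sub>R v \<in> S" if "0 \<le> s" "s \<le> h" "0 \<le> r" "r \<le> h" for s r
    using S[of r s] that by (simp add: add_ac)
  obtain s r where 1: "0 < s" "s < h" "0 < r" "r < h"
    "f (p + h *\<^sub>R v + h *\<^sub>R w) - f (p + h *\<^sub>R v) - f (p + h *\<^sub>R w) + f p = h * h * K (p + s *\<^sub>R v + r *\<^sub>R w)"
    using second_difference_mvt[OF assms(1,2) h S] unfolding K_def by blast
  obtain s' r' where 2: "0 < s'" "s' < h" "0 < r'" "r' < h"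
    "f (p + h *\<^sub>R w + h *\<^sub>R v) - f (p + h *\<^sub>R w) - f (p + h *\<^sub>R v) + f p = h * h * L (p + s' *\<^sub>R w + r' *\<^sub>R v)"
    using second_difference_mvt[OF assms(1,2) h S'] unfolding L_def by blast
  have eq: "p + h *\<^sub>R w + h *\<^sub>R v = p + h *\<^sub>R v + h *\<^sub>R w" by simp
  have "h * h * K (p + s *\<^sub>R v + r *\<^sub>R w) = h * h * L (p + s' *\<^sub>R w + r' *\<^sub>R v)"
    using 1(5) 2(5) unfolding eq by linarith
  then have "K (p + s *\<^sub>R v + r *\<^sub>R w) = L (p + s' *\<^sub>R w + r' *\<^sub>R v)" using h by simp
  moreover have "dist (K (p + s *\<^sub>R v + r *\<^sub>R w)) (K p) < \<bar>K p - L p\<bar> / 2"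
    using near[of s r] 1 by (intro d) (auto simp: d_def)
  moreover have "dist (L (p + s' *\<^sub>R w + r' *\<^sub>R v)) (L p) < \<bar>K p - L p\<bar> / 2"
    using near[of r' s'] 2 by (intro d) (auto simp: d_def add_ac)
  ultimately show False unfolding dist_real_def by argo
qed

section \<open>Calculus rules for directional and partial derivatives\<close>

context
  fixes f g :: "'a::real_normed_vector \<Rightarrow> real" and p :: 'a
  assumes f: "f differentiable (at p)"
begin

lemma pd_linear: "linear (\<lambda>v. pd v f p)"
  using has_derivative_linear[OF has_derivative_pd[OF f]] .

lemma pd_add: "g differentiable (at p) \<Longrightarrow> pd v (\<lambda>p. f p + g p) p = pd v f p + pd v g p"
  using pd_eqI[OF has_derivative_add[OF has_derivative_pd[OF f] has_derivative_pd]] .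

lemma pd_diff: "g differentiable (at p) \<Longrightarrow> pd v (\<lambda>p. f p - g p) p = pd v f p - pd v g p"
  using pd_eqI[OF has_derivative_diff[OF has_derivative_pd[OF f] has_derivative_pd]] .

lemma pd_mult:
  "g differentiable (at p) \<Longrightarrow> pd v (\<lambda>p. f p * g p) p = pd v f p * g p + f p * pd v g p"
  using pd_eqI[OF has_derivative_mult[OF has_derivative_pd[OF f] has_derivative_pd]]
  by (simp add: add.commute)

lemma pd_divide:
  assumes g: "g differentiable (at p)" and nz: "g p \<noteq> 0"
  shows "pd v (\<lambda>p. f p / g p) p = (pd v f p * g p - f p * pd v g p) / (g p * g p)"
  using pd_eqI[OF has_derivative_divide'[OF has_derivative_pd[OF f] has_derivative_pd[OF g] nz]] .

end

lemma pd_minus: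
  fixes f :: "'a::real_normed_vector \<Rightarrow> real"
  shows "f differentiable at p \<Longrightarrow> pd v (\<lambda>p. - f p) p = - pd v f p"
  using pd_eqI[OF has_derivative_minus[OF has_derivative_pd]] .

lemma pd_const: "pd v (\<lambda>p. c) p = 0"
  by (simp add: pd_def)

lemma pd_bounded_linear: "bounded_linear L \<Longrightarrow> pd v L p = L v"
  by (rule pd_eqI[OF bounded_linear_imp_has_derivative])

abbreviation pt :: "(real \<times> real \<Rightarrow> real) \<Rightarrow> real \<times> real \<Rightarrow> real" where "pt \<equiv> pd (1, 0)"
abbreviation px :: "(real \<times> real \<Rightarrow> real) \<Rightarrow> real \<times> real \<Rightarrow> real" where "px \<equiv> pd (0, 1)"
abbreviation Pt :: "(real \<times> real \<times> real \<Rightarrow> real) \<Rightarrow> real \<times> real \<times> real \<Rightarrow> real" where "Pt \<equiv> pd (1, 0, 0)"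
abbreviation Px :: "(real \<times> real \<times> real \<Rightarrow> real) \<Rightarrow> real \<times> real \<times> real \<Rightarrow> real" where "Px \<equiv> pd (0, 1, 0)"
abbreviation Pu :: "(real \<times> real \<times> real \<Rightarrow> real) \<Rightarrow> real \<times> real \<times> real \<Rightarrow> real" where "Pu \<equiv> pd (0, 0, 1)"

lemma pd_decompose_2:
  assumes "f differentiable (at p)"
  shows "pd (a, b) f p = a * pt f p + b * px f p"
proof -
  note l = pd_linear[OF assms]
  have "pd (a, b) f p = pd (a *\<^sub>R (1, 0) + b *\<^sub>R (0, 1)) f p" by simp
  also have "\<dots> = a * pt f p + b * px f p" unfolding linear_add[OF l] linear_scale[OF l] by simp
  finally show ?thesis .
qed

lemma pd_decompose_3:
  assumes "f differentiable (at p)"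
  shows "pd (a, b, c) f p = a * Pt f p + b * Px f p + c * Pu f p"
proof -
  note l = pd_linear[OF assms]
  have "pd (a, b, c) f p = pd (a *\<^sub>R (1, 0, 0) + b *\<^sub>R (0, 1, 0) + c *\<^sub>R (0, 0, 1)) f p" by simp
  also have "\<dots> = a * Pt f p + b * Px f p + c * Pu f p"
    unfolding linear_add[OF l] linear_scale[OF l] by simp
  finally show ?thesis .
qed

lemma has_derivative_compose_2:
  fixes k :: "real \<times> real \<Rightarrow> real"
  assumes "(a has_derivative a') (at p)" "(b has_derivative b') (at p)"
    and k: "k differentiable (at (a p, b p))"
  shows "((\<lambda>q. k (a q, b q)) has_derivative (\<lambda>v. pt k (a p, b p) * a' v + px k (a p, b p) * b' v)) (at p)"
  using has_derivative_compose[OF has_derivative_Pair[OF assms(1,2)] has_derivative_pd[OF k]]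
  unfolding pd_decompose_2[OF k, of "a' _"] by (simp only: mult.commute)

lemma pd_compose_2:
  fixes k :: "real \<times> real \<Rightarrow> real"
  assumes a: "a differentiable (at p)" and b: "b differentiable (at p)"
    and k: "k differentiable (at (a p, b p))"
  shows "pd v (\<lambda>q. k (a q, b q)) p = pt k (a p, b p) * pd v a p + px k (a p, b p) * pd v b p"
  by (rule pd_eqI[OF has_derivative_compose_2[OF has_derivative_pd[OF a] has_derivative_pd[OF b] k]])

lemma DERIV_compose_2:
  fixes k :: "real \<times> real \<Rightarrow> real"
  assumes "(a has_real_derivative a') (at s)" "(b has_real_derivative b') (at s)"
    and "k differentiable (at (a s, b s))"
  shows "((\<lambda>s. k (a s, b s)) has_real_derivative (pt k (a s, b s) * a' + px k (a s, b s) * b')) (at s)"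
  using has_derivative_compose_2[OF assms(1,2)[unfolded has_field_derivative_def] assms(3)]
  unfolding has_field_derivative_def
  by (rule has_derivative_eq_rhs) (simp add: fun_eq_iff algebra_simps)

lemma DERIV_slice_t:
  assumes "f differentiable (at (t, x))"
  shows "((\<lambda>s. f (s, x)) has_real_derivative pt f (t, x)) (at t)"
  using DERIV_compose_2[OF DERIV_ident DERIV_const assms] by simp

lemma DERIV_slice_x:
  assumes "f differentiable (at (t, x))"
  shows "((\<lambda>y. f (t, y)) has_real_derivative px f (t, x)) (at x)"
  using DERIV_compose_2[OF DERIV_const DERIV_ident assms] by simp

lemma deriv2_slice_x:
  assumes "open D" "smooth_on D f" "(t, x) \<in> D"
  shows "(deriv ^^ 2) (\<lambda>y. f (t, y)) x = px (px f) (t, x)"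
proof -
  have "open ((\<lambda>y. (t, y)) -` D)"
    by (rule open_vimage[OF assms(1)]) (intro continuous_intros)
  then have "\<forall>\<^sub>F y in nhds x. (t, y) \<in> D"
    using assms(3) eventually_nhds_in_open[of "(\<lambda>y. (t, y)) -` D" x] by simp
  then have "\<forall>\<^sub>F y in nhds x. deriv (\<lambda>y. f (t, y)) y = px f (t, y)"
    by eventually_elim (intro DERIV_imp_deriv DERIV_slice_x smooth_on_differentiable[OF assms(2)])
  then have "deriv (deriv (\<lambda>y. f (t, y))) x = deriv (\<lambda>y. px f (t, y)) x"
    by (intro deriv_cong_ev refl)
  also have "\<dots> = px (px f) (t, x)"
    by (intro DERIV_imp_deriv DERIV_slice_x smooth_on_differentiable[OF smooth_on_pd[OF assms(2)] assms(3)])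
  finally show ?thesis by (simp add: numeral_2_eq_2)
qed

section \<open>Heat solutions in terms of partial derivatives\<close>

lemma heat_solution_iff_pd:
  "heat_solution D f \<longleftrightarrow> open D \<and> smooth_on D f \<and> (\<forall>q\<in>D. pt f q = px (px f) q)"
proof (cases "open D \<and> smooth_on D f")
  case True
  then have "deriv (\<lambda>s. f (s, x)) t = pt f (t, x)" if "(t, x) \<in> D" for t x
    using that by (intro DERIV_imp_deriv DERIV_slice_t smooth_on_differentiable) auto
  then show ?thesis
    using True deriv2_slice_x[of D f] by (auto simp: heat_solution_def)
qed (auto simp: heat_solution_def)

lemma heat_solution_cong:
  assumes "heat_solution D f" "\<And>q. q \<in> D \<Longrightarrow> f q = g q"
  shows "heat_solution D g"
proof -
  have D: "open D" "smooth_on D f" using assms by (auto simp: heat_solution_def)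
  have 1: "pd v f q = pd v g q" if "q \<in> D" for v q
    using pd_cong[OF D(1) that] assms(2) by metis
  then have "pd w (pd v f) q = pd w (pd v g) q" if "q \<in> D" for v w q
    using pd_cong[OF D(1) that] by metis
  with 1 show ?thesis
    using assms(1) smooth_on_cong[OF D assms(2)] by (simp add: heat_solution_iff_pd)
qed

lemma heat_solution_subset: "heat_solution D f \<Longrightarrow> open D' \<Longrightarrow> D' \<subseteq> D \<Longrightarrow> heat_solution D' f"
  using smooth_on_subset by (auto simp: heat_solution_iff_pd)

lemma heat_solution_add:
  assumes "heat_solution D f" "heat_solution D g"
  shows "heat_solution D (\<lambda>q. f q + g q)"
proof -
  have D: "open D" and s: "smooth_on D f" "smooth_on D g"
    using assms by (auto simp: heat_solution_def)
  note d = smooth_on_differentiable[OF s(1)] smooth_on_differentiable[OF s(2)]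
    smooth_on_differentiable[OF smooth_on_pd[OF s(1)]] smooth_on_differentiable[OF smooth_on_pd[OF s(2)]]
  have 1: "pd v (\<lambda>q. f q + g q) q = pd v f q + pd v g q" if "q \<in> D" for v q
    by (simp add: pd_add d that)
  have "px (px (\<lambda>q. f q + g q)) q = px (px f) q + px (px g) q" if q: "q \<in> D" for q
    using pd_cong[OF D q 1] by (simp add: pd_add d q)
  then show ?thesis
    using assms 1 D smooth_on_add[OF D s] by (simp add: heat_solution_iff_pd)
qed

text \<open>The inverse function theorem supplies a differentiable local inverse G with derivative
  \<open>M (G y)\<close>. As \<open>M\<close> is smooth, G being C^k makes this derivative C^k and
  thus G of class C^(k+1).\<close>

lemma smooth_inverse_2:
  fixes F1 F2 :: "real \<times> real \<Rightarrow> real"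
  assumes D: "open D" and F: "smooth_on D F1" "smooth_on D F2" and p: "p \<in> D"
    and J: "pt F1 p * px F2 p - px F1 p * pt F2 p \<noteq> 0"
  obtains D' E G where "open D'" "D' \<subseteq> D" "p \<in> D'" "open E"
    "homeomorphism D' E (\<lambda>q. (F1 q, F2 q)) G" "smooth_on E G"
proof -
  define J where "J q = pt F1 q * px F2 q - px F1 q * pt F2 q" for q
  have sJ: "smooth_on D J"
    unfolding J_def by (intro smooth_on_intros D F)
  define V where "V = D \<inter> J -` (- {0})"
  have V: "open V" "V \<subseteq> D" "p \<in> V" and JV: "\<And>q. q \<in> V \<Longrightarrow> J q \<noteq> 0"
    using continuous_open_preimage[OF smooth_on_continuous_on[OF sJ] D, of "- {0}"] p assms(5)
    by (auto simp: V_def J_def)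
  define L where "L q = (\<lambda>v. (pd v F1 q, pd v F2 q))" for q
  \<comment> \<open>Cramer's rule for the inverse of \<open>L q\<close>; the explicit entries show
    that it depends smoothly on q.\<close>
  define M where "M q = (\<lambda>w. ((px F2 q * fst w - px F1 q * snd w) / J q,
    (pt F1 q * snd w - pt F2 q * fst w) / J q))" for q
  have L_eq: "L q v = (fst v * pt F1 q + snd v * px F1 q, fst v * pt F2 q + snd v * px F2 q)"
    if "q \<in> V" for q v
  proof -
    have "F1 differentiable (at q)" "F2 differentiable (at q)"
      using that V(2) F by (auto intro: smooth_on_differentiable)
    from this[THEN pd_decompose_2, of "fst v" "snd v"] show ?thesis by (simp add: L_def)
  qed
  have der: "((\<lambda>q. (F1 q, F2 q)) has_derivative L q) (at q)" if "q \<in> V" for q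
    unfolding L_def using that V F
    by (intro has_derivative_Pair smooth_on_has_derivative[of D]) auto
  have bL: "bounded_linear (L q)" if "q \<in> V" for q
    using der[OF that] by (rule has_derivative_bounded_linear)
  have Linv: "L q (M q w) = w" if "q \<in> V" for q w
  proof -
    have j: "J q \<noteq> 0" "J q = pt F1 q * px F2 q - px F1 q * pt F2 q"
      using JV[OF that] by (auto simp: J_def)
    show ?thesis
      unfolding L_eq[OF that] M_def fst_conv snd_conv using j(1)
      by (auto simp: prod_eq_iff divide_simps) (auto simp: j(2) algebra_simps)
  qed
  have invL: "M q (L q v) = v" if "q \<in> V" for q v
  proof -
    have j: "J q \<noteq> 0" "J q = pt F1 q * px F2 q - px F1 q * pt F2 q"
      using JV[OF that] by (auto simp: J_def)
    show ?thesis
      unfolding L_eq[OF that] M_def fst_conv snd_conv using j(1)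
      by (auto simp: prod_eq_iff divide_simps) (auto simp: j(2) algebra_simps)
  qed
  have bM: "bounded_linear (M q)" for q
    unfolding M_def
    by (intro bounded_linear_Pair bounded_linear_divide[THEN bounded_linear_compose] bounded_linear_sub
        bounded_linear_mult_right[THEN bounded_linear_compose] bounded_linear_fst bounded_linear_snd)
  define f' where "f' q = Blinfun (L q)" for q
  have f': "blinfun_apply (f' q) = L q" if "q \<in> V" for q
    unfolding f'_def by (rule bounded_linear_Blinfun_apply[OF bL[OF that]])
  have "continuous_on V (\<lambda>q. blinfun_apply (f' q) i)" for i
  proof -
    have "continuous_on V (\<lambda>q. L q i)"
      unfolding L_def using V F
      by (intro continuous_on_Pair continuous_on_subset[OF smooth_on_continuous_on[OF smooth_on_pd]])
    then show ?thesis by (simp add: f' cong: continuous_on_cong)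
  qed
  then have 1: "continuous_on V f'" by (intro continuous_on_blinfun_componentwise)
  have 2: "Blinfun (M p) o\<^sub>L f' p = id_blinfun"
    by (rule blinfun_eqI) (simp add: bounded_linear_Blinfun_apply[OF bM] f' V invL)
  have 3: "((\<lambda>q. (F1 q, F2 q)) has_derivative blinfun_apply (f' q)) (at q)" if "q \<in> V" for q
    using der that by (simp add: f')
  obtain D' E G G' where *: "open D'" "D' \<subseteq> V" "p \<in> D'" "open E"
      "(F1 p, F2 p) \<in> E" "homeomorphism D' E (\<lambda>q. (F1 q, F2 q)) G"
      "\<And>y. y \<in> E \<Longrightarrow> (G has_derivative (G' y)) (at y)"
      "\<And>y. y \<in> E \<Longrightarrow> G' y = inv (blinfun_apply (f' (G y)))"
      "\<And>y. y \<in> E \<Longrightarrow> bij (blinfun_apply (f' (G y)))"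
    by (rule inverse_function_theorem[OF V(1) 3 1 V(3) 2], assumption) (rule that, assumption+)
  have GV: "G y \<in> V" if "y \<in> E" for y
    using *(2,6) that unfolding homeomorphism_def by blast
  have G': "G' y = M (G y)" if "y \<in> E" for y
    unfolding *(8)[OF that] f'[OF GV[OF that]]
    by (intro inv_unique_comp ext) (simp_all add: Linv invL GV that)
  have M: "smooth_on V (\<lambda>q. M q w)" for w
    unfolding M_def using JV smooth_on_subset[OF F(1) V(2)] smooth_on_subset[OF F(2) V(2)] smooth_on_subset[OF sJ V(2)]
    by (intro smooth_on_intros V(1)) auto
  have "Ck_on k E G" for k
  proof (induction k)
    case 0
    then show ?case using *(6) by (simp add: homeomorphism_def)
  next
    case (Suc k)
    show ?case
    proof (rule Ck_on_SucI[OF *(4)])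
      show "(G has_derivative M (G y)) (at y)" if "y \<in> E" for y
        using *(7)[OF that] G'[OF that] by simp
      show "Ck_on k E (\<lambda>y. M (G y) w)" for w
        using M by (intro Ck_on_compose[OF *(4) V(1) _ Suc.IH GV]) (auto simp: smooth_on_def)
    qed
  qed
  then have "smooth_on E G" by (simp add: smooth_on_def)
  with that[OF *(1) order.trans[OF *(2) V(2)] *(3,4,6)] show ?thesis .
qed

section \<open>The transformed equation in terms of jets\<close>

text \<open>The arguments are the first and second derivatives of the three components along a graph.
The condition is \<open>g\<^sub>s = g\<^sub>y\<^sub>y\<close> for the transformed function \<open>g\<close>, multiplied by the third power of the
Jacobian.\<close>

definition jet_condition ::
  "real \<Rightarrow> real \<Rightarrow> real \<Rightarrow> real \<Rightarrow> real \<Rightarrow> real \<Rightarrow> real \<Rightarrow> real \<Rightarrow> real \<Rightarrow>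
   real \<Rightarrow> real \<Rightarrow> real \<Rightarrow> real \<Rightarrow> real \<Rightarrow> real \<Rightarrow> bool" where
  "jet_condition Tt Tx Ttt Ttx Txx Xt Xx Xtt Xtx Xxx Ut Ux Utt Utx Uxx \<longleftrightarrow>
    (let J = Tt * Xx - Tx * Xt;
         Jt = Ttt * Xx + Tt * Xtx - Ttx * Xt - Tx * Xtt;
         Jx = Ttx * Xx + Tt * Xxx - Txx * Xt - Tx * Xtx;
         P = Tt * Ux - Tx * Ut;
         Pt = Ttt * Ux + Tt * Utx - Ttx * Ut - Tx * Utt;
         Px = Ttx * Ux + Tt * Uxx - Txx * Ut - Tx * Utx
     in J * (Tt * Px - Tx * Pt) = (Ut * Xx - Ux * Xt) * J\<^sup>2 + P * (Tt * Jx - Tx * Jt))"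

text \<open>Write D for the derivation F1_t d/dx - F1_x d/dt. It annihilates F1 and sends F2 to J.
  Since P = J g_y along (F1, F2), applying D gives D P = g_y D J + J^2 g_yy; multiplying by J and
  replacing J g_y by P removes the unknown g_y.\<close>

lemma jet_condition_if_heat_solution:
  assumes g: "heat_solution E g" and D: "open D"
    and sm: "smooth_on D F1" "smooth_on D F2" "smooth_on D W"
    and FE: "\<And>q. q \<in> D \<Longrightarrow> (F1 q, F2 q) \<in> E" and W: "\<And>q. q \<in> D \<Longrightarrow> W q = g (F1 q, F2 q)"
    and q: "q \<in> D"
  shows "jet_condition
    (pt F1 q) (px F1 q) (pt (pt F1) q) (px (pt F1) q) (px (px F1) q)
    (pt F2 q) (px F2 q) (pt (pt F2) q) (px (pt F2) q) (px (px F2) q)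
    (pt W q) (px W q) (pt (pt W) q) (px (pt W) q) (px (px W) q)"
proof -
  have sg: "smooth_on E g" and gE: "\<And>r. r \<in> E \<Longrightarrow> pt g r = px (px g) r"
    using g by (auto simp: heat_solution_iff_pd)
  note dm = smooth_on_differentiable[OF sm(1)] smooth_on_differentiable[OF sm(2)]
    smooth_on_differentiable[OF sm(3)]
    smooth_on_differentiable[OF smooth_on_pd[OF sm(1)]] smooth_on_differentiable[OF smooth_on_pd[OF sm(2)]]
    smooth_on_differentiable[OF smooth_on_pd[OF sm(3)]]
    smooth_on_differentiable[OF sg] smooth_on_differentiable[OF smooth_on_pd[OF sg]]
  have pdW: "pd v W r = pt g (F1 r, F2 r) * pd v F1 r + px g (F1 r, F2 r) * pd v F2 r"
    if "r \<in> D" for v r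
    using pd_cong[OF D that W] by (simp add: pd_compose_2 dm that FE)
  define J where "J r = pt F1 r * px F2 r - px F1 r * pt F2 r" for r
  define P where "P r = pt F1 r * px W r - px F1 r * pt W r" for r
  have pdJ: "pd v J q = pd v (pt F1) q * px F2 q + pt F1 q * pd v (px F2) q -
      (pd v (px F1) q * pt F2 q + px F1 q * pd v (pt F2) q)" for v
    unfolding J_def by (simp add: pd_diff pd_mult dm q)
  have pdP: "pd v P q = pd v (pt F1) q * px W q + pt F1 q * pd v (px W) q -
      (pd v (px F1) q * pt W q + px F1 q * pd v (pt W) q)" for v
    unfolding P_def by (simp add: pd_diff pd_mult dm q)
  have P: "P r = J r * px g (F1 r, F2 r)" if "r \<in> D" for r
    unfolding P_def J_def pdW[OF that] by (simp add: algebra_simps)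
  have sJ: "smooth_on D J" unfolding J_def by (intro smooth_on_intros D sm)
  have sgF: "smooth_on D (\<lambda>r. px g (F1 r, F2 r))"
    using g by (intro smooth_on_compose[OF D _ smooth_on_pd[OF sg]] smooth_on_intros D sm FE)
      (auto simp: heat_solution_def)
  have pdP': "pd v P q = pd v J q * px g (F1 q, F2 q) +
      J q * (pt (px g) (F1 q, F2 q) * pd v F1 q + px (px g) (F1 q, F2 q) * pd v F2 q)" for v
    using pd_cong[OF D q P]
    by (simp add: pd_mult pd_compose_2 dm q FE smooth_on_differentiable[OF sJ] smooth_on_differentiable[OF sgF])
  \<comment> \<open>Cramer's rule gives J g_s on the right; the heat equation for g replaces g_s by
    g_yy.\<close>
  have K: "pt W q * px F2 q - px W q * pt F2 q = J q * px (px g) (F1 q, F2 q)"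
    unfolding pdW[OF q] J_def gE[OF FE[OF q], symmetric] by (simp add: algebra_simps)
  have main: "J q * (pt F1 q * px P q - px F1 q * pt P q) =
    (pt W q * px F2 q - px W q * pt F2 q) * (J q)\<^sup>2 + P q * (pt F1 q * px J q - px F1 q * pt J q)"
    unfolding K pdP' P[OF q] by (simp add: J_def power2_eq_square algebra_simps)
  have comm: "pt (px F1) q = px (pt F1) q" "pt (px F2) q = px (pt F2) q" "pt (px W) q = px (pt W) q"
    by (rule pd_commute[OF D _ q]; rule sm)+
  show ?thesis
    using main unfolding pdP pdJ comm jet_condition_def Let_def unfolding J_def P_def
    by (simp add: algebra_simps)
qed

text \<open>The coefficients \<open>a\<close>, \<open>b\<close>, \<open>e\<close> are the values of \<open>f\<^sub>x\<close>, \<open>f\<^sub>t = f\<^sub>x\<^sub>x\<close> and \<open>f\<^sub>t\<^sub>t\<close> at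
\<open>(t0, x0)\<close>, where \<open>f\<^sub>t\<^sub>x\<close> vanishes.\<close>

definition heat_poly :: "real \<Rightarrow> real \<Rightarrow> real \<Rightarrow> real \<Rightarrow> real \<Rightarrow> real \<Rightarrow> real \<times> real \<Rightarrow> real" where
  "heat_poly t0 x0 u0 a b e = (\<lambda>q. u0 + a * (snd q - x0) + b * ((fst q - t0) + (snd q - x0)^2 / 2) +
     e * ((fst q - t0)^2 / 2 + (fst q - t0) * (snd q - x0)^2 / 2 + (snd q - x0)^4 / 24))"

lemma pd_heat_poly:
  "pt (heat_poly t0 x0 u0 a b e) = (\<lambda>q. b + e * ((fst q - t0) + (snd q - x0)^2 / 2))"
  "px (heat_poly t0 x0 u0 a b e) = (\<lambda>q. a + b * (snd q - x0) + e * ((fst q - t0) * (snd q - x0) + (snd q - x0)^3 / 6))"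
  "pt (\<lambda>q. b + e * ((fst q - t0) + (snd q - x0)^2 / 2)) = (\<lambda>q. e)"
  "px (\<lambda>q. b + e * ((fst q - t0) + (snd q - x0)^2 / 2)) = (\<lambda>q. e * (snd q - x0))"
  "px (\<lambda>q. a + b * (snd q - x0) + e * ((fst q - t0) * (snd q - x0) + (snd q - x0)^3 / 6)) =
    (\<lambda>q. b + e * ((fst q - t0) + (snd q - x0)^2 / 2))"
proof -
  note [simp] = power2_eq_square power3_eq_cube power4_eq_xxxx
  have 1: "(heat_poly t0 x0 u0 a b e has_derivative
      (\<lambda>v. (b + e * ((fst q - t0) + (snd q - x0)^2 / 2)) * fst v +
       (a + b * (snd q - x0) + e * ((fst q - t0) * (snd q - x0) + (snd q - x0)^3 / 6)) * snd v)) (at q)" for q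
    unfolding heat_poly_def
    by (auto intro!: derivative_eq_intros) (auto simp: algebra_simps field_simps)
  have 2: "((\<lambda>q. b + e * ((fst q - t0) + (snd q - x0)^2 / 2)) has_derivative
      (\<lambda>v. e * fst v + (e * (snd q - x0)) * snd v)) (at q)" for q :: "real \<times> real"
    by (auto intro!: derivative_eq_intros) (auto simp: algebra_simps)
  have 3: "((\<lambda>q. a + b * (snd q - x0) + e * ((fst q - t0) * (snd q - x0) + (snd q - x0)^3 / 6)) has_derivative
      (\<lambda>v. (e * (snd q - x0)) * fst v + (b + e * ((fst q - t0) + (snd q - x0)^2 / 2)) * snd v)) (at q)" for q :: "real \<times> real"
    by (auto intro!: derivative_eq_intros) (auto simp: algebra_simps field_simps)
  show "pt (heat_poly t0 x0 u0 a b e) = (\<lambda>q. b + e * ((fst q - t0) + (snd q - x0)^2 / 2))"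
    "px (heat_poly t0 x0 u0 a b e) = (\<lambda>q. a + b * (snd q - x0) + e * ((fst q - t0) * (snd q - x0) + (snd q - x0)^3 / 6))"
    "pt (\<lambda>q. b + e * ((fst q - t0) + (snd q - x0)^2 / 2)) = (\<lambda>q. e)"
    "px (\<lambda>q. b + e * ((fst q - t0) + (snd q - x0)^2 / 2)) = (\<lambda>q. e * (snd q - x0))"
    "px (\<lambda>q. a + b * (snd q - x0) + e * ((fst q - t0) * (snd q - x0) + (snd q - x0)^3 / 6)) =
      (\<lambda>q. b + e * ((fst q - t0) + (snd q - x0)^2 / 2))"
    by (rule ext, simp only: pd_eqI[OF 1] pd_eqI[OF 2] pd_eqI[OF 3] fst_conv snd_conv mult_1_right mult_zero_right
        add_0_left add_0_right)+
qed

lemma heat_solution_heat_poly: "heat_solution UNIV (heat_poly t0 x0 u0 a b e)"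
proof -
  have "smooth_on UNIV (heat_poly t0 x0 u0 a b e)"
    unfolding heat_poly_def by (intro smooth_on_intros open_UNIV) auto
  then show ?thesis by (simp add: heat_solution_iff_pd pd_heat_poly)
qed

section \<open>Graphs and derivatives along them\<close>

lemma graph_over_eq_image: "graph_over D f = (\<lambda>q. (fst q, snd q, f q)) ` D"
  by (force simp: graph_over_def)

lemma graph_over_eqD:
  assumes "graph_over D f = graph_over E g"
  shows "D = E" "\<And>q. q \<in> D \<Longrightarrow> f q = g q"
proof -
  have "q \<in> D \<and> z = f q \<longleftrightarrow> q \<in> E \<and> z = g q" for q z
  proof -
    have "(fst q, snd q, z) \<in> graph_over D f \<longleftrightarrow> (fst q, snd q, z) \<in> graph_over E g"
      by (simp only: assms)
    then show ?thesis by (auto simp: graph_over_def)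
  qed
  then show "D = E" "\<And>q. q \<in> D \<Longrightarrow> f q = g q" by blast+
qed

lemma has_derivative_compose_3:
  fixes k :: "real \<times> real \<times> real \<Rightarrow> real"
  assumes "(a has_derivative a') (at p)" "(b has_derivative b') (at p)" "(c has_derivative c') (at p)"
    and k: "k differentiable (at (a p, b p, c p))"
  shows "((\<lambda>q. k (a q, b q, c q)) has_derivative
    (\<lambda>v. Pt k (a p, b p, c p) * a' v + Px k (a p, b p, c p) * b' v + Pu k (a p, b p, c p) * c' v)) (at p)"
  using has_derivative_compose[OF has_derivative_Pair[OF assms(1) has_derivative_Pair[OF assms(2,3)]] has_derivative_pd[OF k]]
  unfolding pd_decompose_3[OF k, of "a' _"] by (simp only: mult.commute)

context
  fixes k :: "real \<times> real \<times> real \<Rightarrow> real" and f :: "real \<times> real \<Rightarrow> real" and \<Omega> D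
  assumes \<Omega>: "open \<Omega>" and k: "smooth_on \<Omega> k" and D: "open D" and f: "smooth_on D f"
    and graph: "\<forall>q\<in>D. (fst q, snd q, f q) \<in> \<Omega>"
begin

lemma smooth_on_graph: "smooth_on D (\<lambda>q. k (fst q, snd q, f q))"
  by (intro smooth_on_compose[OF D \<Omega> k] smooth_on_intros D f graph[rule_format])

lemma pd_graph:
  assumes "q \<in> D"
  shows "pd v (\<lambda>q. k (fst q, snd q, f q)) q =
    Pt k (fst q, snd q, f q) * fst v + Px k (fst q, snd q, f q) * snd v + Pu k (fst q, snd q, f q) * pd v f q"
  by (rule pd_eqI[OF has_derivative_compose_3]) (auto intro!: derivative_intros
      smooth_on_has_derivative[OF f assms] smooth_on_differentiable[OF k graph[rule_format, OF assms]])

end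

lemma pd2_graph:
  fixes k :: "real \<times> real \<times> real \<Rightarrow> real" and f :: "real \<times> real \<Rightarrow> real"
  assumes \<Omega>: "open \<Omega>" and k: "smooth_on \<Omega> k" and D: "open D" and f: "smooth_on D f"
    and graph: "\<forall>q\<in>D. (fst q, snd q, f q) \<in> \<Omega>" and q: "q \<in> D"
  defines "\<phi> \<equiv> \<lambda>q. (fst q, snd q, f q)"
  shows "pt (pt (\<lambda>q. k (\<phi> q))) q = Pt (Pt k) (\<phi> q) + 2 * pt f q * Pu (Pt k) (\<phi> q) + (pt f q)\<^sup>2 * Pu (Pu k) (\<phi> q)
      + Pu k (\<phi> q) * pt (pt f) q"
    "px (pt (\<lambda>q. k (\<phi> q))) q = Px (Pt k) (\<phi> q) + px f q * Pu (Pt k) (\<phi> q) + pt f q * Pu (Px k) (\<phi> q)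
      + pt f q * px f q * Pu (Pu k) (\<phi> q) + Pu k (\<phi> q) * px (pt f) q"
    "px (px (\<lambda>q. k (\<phi> q))) q = Px (Px k) (\<phi> q) + 2 * px f q * Pu (Px k) (\<phi> q) + (px f q)\<^sup>2 * Pu (Pu k) (\<phi> q)
      + Pu k (\<phi> q) * px (px f) q"
proof -
  note g = pd_graph[OF \<Omega> _ D f graph] and sg = smooth_on_graph[OF \<Omega> _ D f graph]
  note comm = pd_commute[OF \<Omega> k graph[rule_format, OF q]]
  have pt: "pt (\<lambda>q. k (\<phi> q)) r = Pt k (\<phi> r) + Pu k (\<phi> r) * pt f r" if "r \<in> D" for r
    using g[OF k that, of "(1, 0)"] by (simp add: \<phi>_def)
  have px: "px (\<lambda>q. k (\<phi> q)) r = Px k (\<phi> r) + Pu k (\<phi> r) * px f r" if "r \<in> D" for r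
    using g[OF k that, of "(0, 1)"] by (simp add: \<phi>_def)
  have d: "(\<lambda>q. pd v k (\<phi> q)) differentiable at q" "pd w f differentiable at q" for v w
    unfolding \<phi>_def by (intro smooth_on_differentiable[OF sg[OF smooth_on_pd[OF k]] q]
        smooth_on_differentiable[OF smooth_on_pd[OF f] q])+
  have m: "(\<lambda>q. pd v k (\<phi> q) * pd w f q) differentiable at q" for v w
    by (intro differentiable_mult d)
  have "pd w (pt (\<lambda>q. k (\<phi> q))) q = pd w (\<lambda>q. Pt k (\<phi> q) + Pu k (\<phi> q) * pt f q) q"
    "pd w (px (\<lambda>q. k (\<phi> q))) q = pd w (\<lambda>q. Px k (\<phi> q) + Pu k (\<phi> q) * px f q) q" for w
    by (rule pd_cong[OF D q], simp add: pt px)+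
  note e = this[unfolded pd_add[OF d(1) m] pd_mult[OF d(1) d(2)]]
  have gg: "pd w (\<lambda>q. pd v k (\<phi> q)) q =
    Pt (pd v k) (\<phi> q) * fst w + Px (pd v k) (\<phi> q) * snd w + Pu (pd v k) (\<phi> q) * pd w f q" for v w
    unfolding \<phi>_def by (rule g[OF smooth_on_pd[OF k] q])
  have c: "Pt (Pu k) (\<phi> q) = Pu (Pt k) (\<phi> q)" "Px (Pu k) (\<phi> q) = Pu (Px k) (\<phi> q)"
    unfolding \<phi>_def by (rule comm)+
  show "pt (pt (\<lambda>q. k (\<phi> q))) q = Pt (Pt k) (\<phi> q) + 2 * pt f q * Pu (Pt k) (\<phi> q) + (pt f q)\<^sup>2 * Pu (Pu k) (\<phi> q)
      + Pu k (\<phi> q) * pt (pt f) q"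
    "px (pt (\<lambda>q. k (\<phi> q))) q = Px (Pt k) (\<phi> q) + px f q * Pu (Pt k) (\<phi> q) + pt f q * Pu (Px k) (\<phi> q)
      + pt f q * px f q * Pu (Pu k) (\<phi> q) + Pu k (\<phi> q) * px (pt f) q"
    "px (px (\<lambda>q. k (\<phi> q))) q = Px (Px k) (\<phi> q) + 2 * px f q * Pu (Px k) (\<phi> q) + (px f q)\<^sup>2 * Pu (Pu k) (\<phi> q)
      + Pu k (\<phi> q) * px (px f) q"
    unfolding e gg by (simp_all add: c algebra_simps power2_eq_square)
qed

text \<open>\<open>d1\<close>, \<open>d2\<close>, \<open>d11\<close>, \<open>d12\<close>,
  \<open>d22\<close> are the total derivatives at p along the graph of the heat polynomial through p
  with f_x = a, f_t = f_xx = b, f_tt = e and f_tx = 0. The result turns the quantification over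
  solutions into algebraic conditions with the free parameters a, b, e.\<close>

lemma heat_point_symmetry_jet_condition:
  fixes \<Phi> :: "real \<times> real \<times> real \<Rightarrow> real \<times> real \<times> real" and p :: "real \<times> real \<times> real" and a b e :: real
  assumes sym: "heat_point_symmetry \<Omega> \<Phi>" and p: "p \<in> \<Omega>"
  defines "T \<equiv> \<lambda>p. fst (\<Phi> p)" and "X \<equiv> \<lambda>p. fst (snd (\<Phi> p))" and "U \<equiv> \<lambda>p. snd (snd (\<Phi> p))"
  defines "d1 \<equiv> \<lambda>k. Pt k p + Pu k p * b" and "d2 \<equiv> \<lambda>k. Px k p + Pu k p * a"
    and "d11 \<equiv> \<lambda>k. Pt (Pt k) p + 2 * b * Pu (Pt k) p + b\<^sup>2 * Pu (Pu k) p + Pu k p * e"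
    and "d12 \<equiv> \<lambda>k. Px (Pt k) p + a * Pu (Pt k) p + b * Pu (Px k) p + b * a * Pu (Pu k) p"
    and "d22 \<equiv> \<lambda>k. Px (Px k) p + 2 * a * Pu (Px k) p + a\<^sup>2 * Pu (Pu k) p + Pu k p * b"
  assumes J: "d1 T * d2 X - d2 T * d1 X \<noteq> 0"
  shows "jet_condition (d1 T) (d2 T) (d11 T) (d12 T) (d22 T) (d1 X) (d2 X) (d11 X) (d12 X) (d22 X)
    (d1 U) (d2 U) (d11 U) (d12 U) (d22 U)"
proof -
  have \<Omega>: "open \<Omega>" and s\<Phi>: "smooth_on \<Omega> \<Phi>"
    using sym by (auto simp: heat_point_symmetry_def point_transformation_def)
  have sm: "smooth_on \<Omega> T" "smooth_on \<Omega> X" "smooth_on \<Omega> U"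
    unfolding T_def X_def U_def by (intro smooth_on_intros \<Omega> s\<Phi>)+
  obtain t0 x0 u0 where p_eq: "p = (t0, x0, u0)" by (cases p)
  define f where "f = heat_poly t0 x0 u0 a b e"
  have f: "heat_solution UNIV f" "smooth_on UNIV f"
    using heat_solution_heat_poly[of t0 x0 u0 a b e] by (auto simp: f_def heat_solution_def)
  define \<phi> where "\<phi> = (\<lambda>q. (fst q, snd q, f q))"
  have \<phi>p: "\<phi> (t0, x0) = p" by (simp add: \<phi>_def f_def heat_poly_def p_eq)
  define D where "D = \<phi> -` \<Omega>"
  have "continuous_on UNIV \<phi>"
    unfolding \<phi>_def using smooth_on_continuous_on[OF f(2)] by (intro continuous_intros)
  then have D: "open D" unfolding D_def by (intro open_vimage \<Omega>)
  have q0: "(t0, x0) \<in> D" using p by (simp add: D_def \<phi>p)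
  have graph: "\<forall>q\<in>D. (fst q, snd q, f q) \<in> \<Omega>" by (simp add: D_def \<phi>_def)
  have fD: "smooth_on D f" using f(2) by (rule smooth_on_subset) simp
  have jets: "pt f (t0, x0) = b" "px f (t0, x0) = a" "pt (pt f) (t0, x0) = e" "px (pt f) (t0, x0) = 0"
    "px (px f) (t0, x0) = b"
    by (simp_all add: f_def pd_heat_poly)
  have J1: "pt (\<lambda>q. k (\<phi> q)) (t0, x0) = d1 k" "px (\<lambda>q. k (\<phi> q)) (t0, x0) = d2 k"
    "pt (pt (\<lambda>q. k (\<phi> q))) (t0, x0) = d11 k" "px (pt (\<lambda>q. k (\<phi> q))) (t0, x0) = d12 k"
    "px (px (\<lambda>q. k (\<phi> q))) (t0, x0) = d22 k" if "smooth_on \<Omega> k" for k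
    using pd_graph[OF \<Omega> that D fD graph q0] pd2_graph[OF \<Omega> that D fD graph q0]
    by (simp_all add: \<phi>p[unfolded \<phi>_def, simplified] \<phi>_def jets d1_def d2_def d11_def d12_def d22_def)
  have sF: "smooth_on D (\<lambda>q. k (\<phi> q))" if "smooth_on \<Omega> k" for k :: "real \<times> real \<times> real \<Rightarrow> real"
    unfolding \<phi>_def by (rule smooth_on_graph[OF \<Omega> that D fD graph])
  have J0: "pt (\<lambda>q. T (\<phi> q)) (t0, x0) * px (\<lambda>q. X (\<phi> q)) (t0, x0) -
      px (\<lambda>q. T (\<phi> q)) (t0, x0) * pt (\<lambda>q. X (\<phi> q)) (t0, x0) \<noteq> 0"
    unfolding J1[OF sm(1)] J1[OF sm(2)] by (rule J)
  obtain D' E G where *: "open D'" "D' \<subseteq> D" "(t0, x0) \<in> D'" "open E"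
    "homeomorphism D' E (\<lambda>q. (T (\<phi> q), X (\<phi> q))) G" "smooth_on E G"
    by (rule smooth_inverse_2[OF D sF[OF sm(1)] sF[OF sm(2)] q0 J0])
  \<comment> \<open>On the small domain where (T, X) along the graph is invertible, the image of the
    graph is the graph of this function.\<close>
  define g where "g = (\<lambda>r. U (\<phi> (G r)))"
  have G: "G (T (\<phi> q), X (\<phi> q)) = q" "(T (\<phi> q), X (\<phi> q)) \<in> E" if "q \<in> D'" for q
    using *(5) that unfolding homeomorphism_def by blast+
  have G': "(T (\<phi> (G r)), X (\<phi> (G r))) = r" "G r \<in> D'" if "r \<in> E" for r
    using *(5) that unfolding homeomorphism_def by blast+
  have sg: "smooth_on E g"
    unfolding g_def by (rule smooth_on_compose[OF *(4) D sF[OF sm(3)] *(6)]) (use G' *(2) in auto)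
  have \<Phi>: "\<Phi> r = (T r, X r, U r)" for r by (simp add: T_def X_def U_def)
  have "\<Phi> ` graph_over D' f = graph_over E g"
  proof -
    have "\<Phi> ` graph_over D' f = (\<lambda>q. (T (\<phi> q), X (\<phi> q), U (\<phi> q))) ` D'"
      by (simp add: graph_over_eq_image image_image \<phi>_def[symmetric] \<Phi>) (simp add: \<phi>_def)
    also have "\<dots> = (\<lambda>r. (fst r, snd r, g r)) ` E"
    proof (intro set_eqI iffI; elim imageE)
      fix y q assume "y = (T (\<phi> q), X (\<phi> q), U (\<phi> q))" "q \<in> D'"
      with G[of q] show "y \<in> (\<lambda>r. (fst r, snd r, g r)) ` E"
        by (intro image_eqI[of _ _ "(T (\<phi> q), X (\<phi> q))"]) (auto simp: g_def)
    next
      fix y r assume "y = (fst r, snd r, g r)" "r \<in> E"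
      with G'[of r] show "y \<in> (\<lambda>q. (T (\<phi> q), X (\<phi> q), U (\<phi> q))) ` D'"
        by (intro image_eqI[of _ _ "G r"]) (auto simp: g_def prod_eq_iff)
    qed
    finally show ?thesis by (simp add: graph_over_eq_image)
  qed
  moreover have "heat_solution D' f" using heat_solution_subset[OF f(1) *(1)] by simp
  moreover have "graph_over D' f \<subseteq> \<Omega>" using graph *(2) by (auto simp: graph_over_eq_image)
  ultimately have "heat_solution E g"
    using sym *(4) sg unfolding heat_point_symmetry_def by blast
  note jc = jet_condition_if_heat_solution[OF this *(1) sF[OF sm(1), THEN smooth_on_subset, OF *(2)]
      sF[OF sm(2), THEN smooth_on_subset, OF *(2)] sF[OF sm(3), THEN smooth_on_subset, OF *(2)] _ _ *(3)]
  show ?thesis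
    using jc unfolding J1[OF sm(1)] J1[OF sm(2)] J1[OF sm(3)] by (simp add: G g_def)
qed

text \<open>Only the second \<open>t\<close>-derivatives depend on the parameter \<open>e\<close> of the heat polynomial; comparing
\<open>e = 0\<close> with \<open>e = 1\<close> isolates the Jacobian determinant.\<close>

lemma jet_condition_Ttt:
  assumes "jet_condition Tt Tx Ttt Ttx Txx Xt Xx Xtt Xtx Xxx Ut Ux Utt Utx Uxx"
    and "jet_condition Tt Tx (Ttt + Tu) Ttx Txx Xt Xx (Xtt + Xu) Xtx Xxx Ut Ux (Utt + Uu) Utx Uxx"
  shows "Tx * Tx * (Tt * (Xx * Uu - Xu * Ux) - Tx * (Xt * Uu - Xu * Ut) + Tu * (Xt * Ux - Xx * Ut)) = 0"
  using assms unfolding jet_condition_def Let_def by (simp add: power2_eq_square) algebra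

section \<open>Determining equations\<close>

lemma pd_eq_zero:
  assumes "open S" "p \<in> S" "\<And>q. q \<in> S \<Longrightarrow> f q = c"
  shows "pd v f p = 0"
  using pd_cong[OF assms(1,2), of f "\<lambda>_. c"] assms(3) by (simp add: pd_const)

text \<open>Multiplicativity of the determinant: the rows p, q, r form a left inverse of the matrix
  with rows (a, b, c), (d, e, f), (g, h, i), so the product of the two determinants is 1.\<close>

lemma det3_nonzero_if_left_inverse:
  fixes a :: real
  assumes "p1*a + p2*d + p3*g = 1" "p1*b + p2*e + p3*h = 0" "p1*c + p2*f + p3*i = 0"
    "q1*a + q2*d + q3*g = 0" "q1*b + q2*e + q3*h = 1" "q1*c + q2*f + q3*i = 0"
    "r1*a + r2*d + r3*g = 0" "r1*b + r2*e + r3*h = 0" "r1*c + r2*f + r3*i = 1"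
  shows "a * (e * i - f * h) - b * (d * i - f * g) + c * (d * h - e * g) \<noteq> 0"
proof -
  let ?D = "\<lambda>a b c d e f g h i. a * (e * i - f * h) - b * (d * i - f * g) + c * (d * h - e * g) :: real"
  have "?D p1 p2 p3 q1 q2 q3 r1 r2 r3 * ?D a b c d e f g h i =
    ?D (p1*a + p2*d + p3*g) (p1*b + p2*e + p3*h) (p1*c + p2*f + p3*i)
      (q1*a + q2*d + q3*g) (q1*b + q2*e + q3*h) (q1*c + q2*f + q3*i)
      (r1*a + r2*d + r3*g) (r1*b + r2*e + r3*h) (r1*c + r2*f + r3*i)"
    by algebra
  also have "\<dots> = 1" unfolding assms by simp
  finally show ?thesis by auto
qed

text \<open>With T_x = T_xx = 0 the terms containing T_tx cancel, and T_t^2 is a common factor of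
  what remains.\<close>

lemma jet_condition_reduced:
  assumes "jet_condition Tt 0 Ttt Ttx 0 Xt Xx Xtt Xtx Xxx Ut Ux Utt Utx Uxx" "Tt \<noteq> 0"
  shows "Tt * (Xx * Uxx - Ux * Xxx) = (Ut * Xx - Ux * Xt) * Xx\<^sup>2"
proof -
  have "Tt * Tt * (Tt * (Xx * Uxx - Ux * Xxx)) = Tt * Tt * ((Ut * Xx - Ux * Xt) * Xx\<^sup>2)"
    using assms(1) unfolding jet_condition_def Let_def by (simp add: power2_eq_square) algebra
  then show ?thesis using assms(2) by simp
qed

locale heat_symmetry =
  fixes \<Omega> :: "(real \<times> real \<times> real) set" and T X U :: "real \<times> real \<times> real \<Rightarrow> real"
  assumes sym: "heat_point_symmetry \<Omega> (\<lambda>p. (T p, X p, U p))"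
begin

lemma open_\<Omega>: "open \<Omega>"
  using sym by (simp add: heat_point_symmetry_def point_transformation_def)

lemma smooth: "smooth_on \<Omega> T" "smooth_on \<Omega> X" "smooth_on \<Omega> U"
proof -
  have s: "smooth_on \<Omega> (\<lambda>p. (T p, X p, U p))"
    using sym by (simp add: heat_point_symmetry_def point_transformation_def)
  show "smooth_on \<Omega> T" "smooth_on \<Omega> X" "smooth_on \<Omega> U"
    using smooth_on_fst[OF open_\<Omega> s] smooth_on_fst[OF open_\<Omega> smooth_on_snd[OF open_\<Omega> s]]
      smooth_on_snd[OF open_\<Omega> smooth_on_snd[OF open_\<Omega> s]] by simp_all
qed

text \<open>The chain rule for \<Psi> after \<Phi>, taken in each coordinate of \<Psi>, yields the
  nine entries of a left inverse of the Jacobian matrix of \<Phi>. In \<open>chain\<close>, L is the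
  coordinate projection.\<close>

lemma det_nonzero:
  assumes p: "p \<in> \<Omega>"
  shows "Pt T p * (Px X p * Pu U p - Pu X p * Px U p) - Px T p * (Pt X p * Pu U p - Pu X p * Pt U p)
    + Pu T p * (Pt X p * Px U p - Px X p * Pt U p) \<noteq> 0"
proof -
  define \<Phi> where "\<Phi> = (\<lambda>p. (T p, X p, U p))"
  have "point_transformation \<Omega> \<Phi>" using sym by (simp add: heat_point_symmetry_def \<Phi>_def)
  then have o: "open (\<Phi> ` \<Omega>)" and "\<exists>\<Psi>. smooth_on (\<Phi> ` \<Omega>) \<Psi> \<and> (\<forall>q\<in>\<Omega>. \<Psi> (\<Phi> q) = q)"
    unfolding point_transformation_def by simp_all
  then obtain \<Psi> where s: "smooth_on (\<Phi> ` \<Omega>) \<Psi>" and inv: "\<And>q. q \<in> \<Omega> \<Longrightarrow> \<Psi> (\<Phi> q) = q"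
    by blast
  have chain: "Pt k (\<Phi> p) * pd v T p + Px k (\<Phi> p) * pd v X p + Pu k (\<Phi> p) * pd v U p = L v"
    if k: "smooth_on (\<Phi> ` \<Omega>) k" and L: "bounded_linear L" "\<And>q. q \<in> \<Omega> \<Longrightarrow> k (\<Phi> q) = L q" for k L v
  proof -
    have "k differentiable (at (T p, X p, U p))"
      using smooth_on_differentiable[OF k, of "\<Phi> p"] p by (simp add: \<Phi>_def)
    from pd_eqI[OF has_derivative_compose_3[OF smooth_on_has_derivative[OF smooth(1) p]
          smooth_on_has_derivative[OF smooth(2) p] smooth_on_has_derivative[OF smooth(3) p] this], of v]
    show ?thesis
      using pd_cong[OF open_\<Omega> p L(2)] pd_bounded_linear[OF L(1), of v p] by (simp add: \<Phi>_def)
  qed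
  have c: "smooth_on (\<Phi> ` \<Omega>) (\<lambda>r. fst (\<Psi> r))" "smooth_on (\<Phi> ` \<Omega>) (\<lambda>r. fst (snd (\<Psi> r)))"
    "smooth_on (\<Phi> ` \<Omega>) (\<lambda>r. snd (snd (\<Psi> r)))"
    by (intro smooth_on_intros o s)+
  note bl = bounded_linear_fst bounded_linear_snd
    bounded_linear_compose[OF bounded_linear_fst bounded_linear_snd]
    bounded_linear_compose[OF bounded_linear_snd bounded_linear_snd]
  note e1 = chain[OF c(1) bl(1)] and e2 = chain[OF c(2) bl(3)] and e3 = chain[OF c(3) bl(4)]
  show ?thesis
    by (rule det3_nonzero_if_left_inverse; (subst e1 e2 e3; simp add: inv))
qed

lemma jets:
  fixes a b e :: real and p
  assumes "p \<in> \<Omega>"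
  defines "d1 \<equiv> \<lambda>k. Pt k p + Pu k p * b" and "d2 \<equiv> \<lambda>k. Px k p + Pu k p * a"
    and "d11 \<equiv> \<lambda>k. Pt (Pt k) p + 2 * b * Pu (Pt k) p + b\<^sup>2 * Pu (Pu k) p + Pu k p * e"
    and "d12 \<equiv> \<lambda>k. Px (Pt k) p + a * Pu (Pt k) p + b * Pu (Px k) p + b * a * Pu (Pu k) p"
    and "d22 \<equiv> \<lambda>k. Px (Px k) p + 2 * a * Pu (Px k) p + a\<^sup>2 * Pu (Pu k) p + Pu k p * b"
  assumes "d1 T * d2 X - d2 T * d1 X \<noteq> 0"
  shows "jet_condition (d1 T) (d2 T) (d11 T) (d12 T) (d22 T) (d1 X) (d2 X) (d11 X) (d12 X) (d22 X)
    (d1 U) (d2 U) (d11 U) (d12 U) (d22 U)"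
  using heat_point_symmetry_jet_condition[OF sym assms(1), of b a e] assms(7)
  unfolding d1_def d2_def d11_def d12_def d22_def by simp

text \<open>Along a graph the Jacobian of (T, X) is A + B b + C a, the terms in a b cancelling. Its
  coefficients are, up to sign, the 2-by-2 minors of the first two rows of the full Jacobian matrix,
  so they are not all zero. Wherever it is nonzero, T_x + T_u a must vanish, and two such values of
  a suffice.\<close>

lemma T_x_T_u:
  assumes p: "p \<in> \<Omega>"
  shows "Px T p = 0" "Pu T p = 0"
proof -
  define A where "A = Pt T p * Px X p - Px T p * Pt X p"
  define B where "B = Pu T p * Px X p - Px T p * Pu X p"
  define C where "C = Pt T p * Pu X p - Pu T p * Pt X p"
  define \<Delta> where "\<Delta> = Pt T p * (Px X p * Pu U p - Pu X p * Px U p) - Px T p * (Pt X p * Pu U p - Pu X p * Pt U p)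
    + Pu T p * (Pt X p * Px U p - Px X p * Pt U p)"
  have \<Delta>: "\<Delta> \<noteq> 0" unfolding \<Delta>_def by (rule det_nonzero[OF p])
  have main: "Px T p + Pu T p * a = 0" if "A + B * b + C * a \<noteq> 0" for a b
  proof -
    have J: "(Pt T p + Pu T p * b) * (Px X p + Pu X p * a) - (Px T p + Pu T p * a) * (Pt X p + Pu X p * b) \<noteq> 0"
      using that unfolding A_def B_def C_def by (simp add: algebra_simps)
    from jet_condition_Ttt[OF jets[OF p J, of 0, unfolded mult_zero_right add_0_right]
        jets[OF p J, of 1, unfolded mult_1_right]]
    have "(Px T p + Pu T p * a) * (Px T p + Pu T p * a) * \<Delta> = 0"
      unfolding \<Delta>_def by algebra
    then show ?thesis using \<Delta> by simp
  qed
  have "A \<noteq> 0 \<or> B \<noteq> 0 \<or> C \<noteq> 0"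
  proof (rule ccontr)
    assume "\<not> ?thesis"
    moreover have "\<Delta> = A * Pu U p + B * Pt U p * (-1) - C * Px U p"
      unfolding \<Delta>_def A_def B_def C_def by algebra
    ultimately show False using \<Delta> by simp
  qed
  then obtain a1 b1 a2 b2 where "A + B * b1 + C * a1 \<noteq> 0" "A + B * b2 + C * a2 \<noteq> 0" "a1 \<noteq> a2"
  proof (cases "B = 0")
    case False
    then show ?thesis
      \<comment> \<open>These choices of b make the Jacobian equal to 1 for a = 0 and for a =
        1.\<close>
      by (intro that[of "(1 - A) / B" 0 "(1 - A - C) / B" 1]) (simp_all add: field_simps)
  next
    case True
    \<comment> \<open>For B = 0 an affine function of a, not identically zero, has at most one zero
      among 0, 1, 2.\<close>
    then have "A \<noteq> 0 \<and> A + C * 1 \<noteq> 0 \<or> A \<noteq> 0 \<and> A + C * 2 \<noteq> 0 \<or> A + C * 1 \<noteq> 0 \<and> A + C * 2 \<noteq> 0"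
      using \<open>A \<noteq> 0 \<or> B \<noteq> 0 \<or> C \<noteq> 0\<close> by auto
    then show ?thesis
      using that[of 0 0 0 1] that[of 0 0 0 2] that[of 0 1 0 2] True by fastforce
  qed
  moreover note main[OF this(1)] main[OF this(2)]
  moreover have "Pu T p * (a1 - a2) = 0"
    using calculation(4,5) unfolding right_diff_distrib by linarith
  ultimately show "Pu T p = 0" "Px T p = 0" by auto
qed

lemma T_t_nonzero: "p \<in> \<Omega> \<Longrightarrow> Pt T p \<noteq> 0"
  and minor_nonzero: "p \<in> \<Omega> \<Longrightarrow> Px X p * Pu U p - Pu X p * Px U p \<noteq> 0"
  using det_nonzero[of p] T_x_T_u[of p] by auto

lemma reduced_condition:
  assumes p: "p \<in> \<Omega>" and a: "Px X p + Pu X p * a \<noteq> 0"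
  shows "Pt T p * ((Px X p + Pu X p * a) * (Px (Px U) p + 2 * a * Pu (Px U) p + a\<^sup>2 * Pu (Pu U) p + Pu U p * b) -
      (Px U p + Pu U p * a) * (Px (Px X) p + 2 * a * Pu (Px X) p + a\<^sup>2 * Pu (Pu X) p + Pu X p * b)) =
    ((Pt U p + Pu U p * b) * (Px X p + Pu X p * a) - (Px U p + Pu U p * a) * (Pt X p + Pu X p * b)) *
      (Px X p + Pu X p * a)\<^sup>2"
proof -
  have 0: "Px (Px T) p = 0" "Pu (Px T) p = 0" "Pu (Pu T) p = 0"
    by (rule pd_eq_zero[OF open_\<Omega> p]; simp add: T_x_T_u)+
  have "(Pt T p + Pu T p * b) * (Px X p + Pu X p * a) - (Px T p + Pu T p * a) * (Pt X p + Pu X p * b) \<noteq> 0"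
    using a T_t_nonzero[OF p] by (simp add: T_x_T_u p)
  from jets[OF p this, of 0] show ?thesis
    by (intro jet_condition_reduced T_t_nonzero[OF p]) (simp add: T_x_T_u p 0)
qed

text \<open>The reduced condition is affine in b = f_t. The difference of its instances at b = 1 and
  b = 0 is the equality of the coefficients of b, which share the nonzero minor as a factor.\<close>

lemma T_t_eq_if:
  assumes p: "p \<in> \<Omega>" and a: "Px X p + Pu X p * a \<noteq> 0"
  shows "Pt T p = (Px X p + Pu X p * a)\<^sup>2"
proof -
  have "(Px X p * Pu U p - Pu X p * Px U p) * Pt T p =
      (Px X p * Pu U p - Pu X p * Px U p) * (Px X p + Pu X p * a)\<^sup>2"
    using reduced_condition[OF p a, of 0] reduced_condition[OF p a, of 1] by algebra
  then show ?thesis using minor_nonzero[OF p] by simp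
qed

lemma X_u:
  assumes p: "p \<in> \<Omega>"
  shows "Pu X p = 0"
proof (rule ccontr)
  assume n: "Pu X p \<noteq> 0"
  \<comment> \<open>If X_u were nonzero, a could be chosen to give X_x + X_u a any nonzero value c,
    while T_t is one fixed number.\<close>
  have "Pt T p = c\<^sup>2" if "c \<noteq> 0" for c
    using T_t_eq_if[OF p, of "(c - Px X p) / Pu X p"] n that by simp
  from this[of 1] this[of 2] show False by simp
qed

lemma X_x_nonzero: "p \<in> \<Omega> \<Longrightarrow> Px X p \<noteq> 0"
  and U_u_nonzero: "p \<in> \<Omega> \<Longrightarrow> Pu U p \<noteq> 0"
  using minor_nonzero[of p] by (auto simp: X_u)

lemma T_t: "p \<in> \<Omega> \<Longrightarrow> Pt T p = (Px X p)\<^sup>2"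
  using T_t_eq_if[of p 0] X_x_nonzero[of p] by simp

lemma differentiable:
  assumes "p \<in> \<Omega>"
  shows "T differentiable at p" "X differentiable at p" "U differentiable at p"
    "pd v T differentiable at p" "pd v X differentiable at p" "pd v U differentiable at p"
    "pd w (pd v T) differentiable at p" "pd w (pd v X) differentiable at p" "pd w (pd v U) differentiable at p"
  by (intro smooth_on_differentiable[OF _ assms] smooth_on_pd smooth)+

text \<open>T is independent of x, so the x-derivative of T_t = X_x^2 vanishes: 2 X_x X_xx =
  0.\<close>

lemma X_xx:
  assumes p: "p \<in> \<Omega>"
  shows "Px (Px X) p = 0" "Pu (Px X) p = 0"
proof -
  have "Px (Pt T) p = Pt (Px T) p" "Pu (Px X) p = Px (Pu X) p"
    by (intro pd_commute[OF open_\<Omega> _ p] smooth)+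
  moreover have "Pt (Px T) p = 0" "Px (Pu X) p = 0"
    by (rule pd_eq_zero[OF open_\<Omega> p]; simp add: T_x_T_u X_u)+
  moreover have "Px (Pt T) p = Px (\<lambda>p. Px X p * Px X p) p"
    by (rule pd_cong[OF open_\<Omega> p]) (simp add: T_t power2_eq_square)
  ultimately show "Px (Px X) p = 0" "Pu (Px X) p = 0"
    using X_x_nonzero[OF p] by (auto simp: pd_mult differentiable p)
qed

text \<open>After cancelling X_x^2 = T_t the condition is a quadratic identity in a = f_x. Its
  values at 0, 1 and -1 separate the three coefficients.\<close>

lemma U_equations:
  assumes p: "p \<in> \<Omega>"
  shows "Pu (Pu U) p = 0" "2 * Px X p * Pu (Px U) p = - (Pu U p * Pt X p)"
    "Px X p * Px (Px U) p = Pt U p * Px X p - Px U p * Pt X p"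
proof -
  have 0: "Pu (Pu X) p = 0" by (rule pd_eq_zero[OF open_\<Omega> p]) (simp add: X_u)
  have nz: "Px X p \<noteq> 0" by (rule X_x_nonzero[OF p])
  have E: "Px X p * (Px (Px U) p + 2 * a * Pu (Px U) p + a\<^sup>2 * Pu (Pu U) p) =
      Pt U p * Px X p - (Px U p + Pu U p * a) * Pt X p" for a
  proof -
    have "(Px X p)\<^sup>2 * (Px X p * (Px (Px U) p + 2 * a * Pu (Px U) p + a\<^sup>2 * Pu (Pu U) p)) =
      (Px X p)\<^sup>2 * (Pt U p * Px X p - (Px U p + Pu U p * a) * Pt X p)"
      using reduced_condition[OF p, of a 0] nz by (simp add: X_u p 0 X_xx T_t mult_ac)
    then show ?thesis using nz by simp
  qed
  have e: "Px X p * Px (Px U) p = Pt U p * Px X p - Px U p * Pt X p"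
    using E[of 0] by simp
  have "Px X p * Pu (Pu U) p = 0"
    using E[of 1] E[of "-1"] e by (simp add: algebra_simps)
  then have uu: "Pu (Pu U) p = 0" using nz by simp
  show "Pu (Pu U) p = 0" "2 * Px X p * Pu (Px U) p = - (Pu U p * Pt X p)"
    "Px X p * Px (Px U) p = Pt U p * Px X p - Px U p * Pt X p"
    using uu e E[of 1] by (auto simp: algebra_simps)
qed

end

section \<open>Integration of the determining equations\<close>

lemma constant_if_partials_zero:
  assumes N: "open N" "convex N" and f: "\<And>p. p \<in> N \<Longrightarrow> f differentiable at p"
    and 0: "\<And>p. p \<in> N \<Longrightarrow> Pt f p = 0" "\<And>p. p \<in> N \<Longrightarrow> Px f p = 0" "\<And>p. p \<in> N \<Longrightarrow> Pu f p = 0"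
  shows "\<exists>c. \<forall>p\<in>N. f p = c"
proof (rule has_derivative_zero_constant[OF N(2)])
  fix p assume p: "p \<in> N"
  have "pd v f p = 0" for v
    using pd_decompose_3[OF f[OF p], of "fst v" "fst (snd v)" "snd (snd v)"] by (simp add: 0 p)
  then show "(f has_derivative (\<lambda>h. 0)) (at p within N)"
    using has_derivative_pd[OF f[OF p]] by (simp add: has_derivative_at_withinI)
qed

text \<open>The slope is returned also as the value of the t-derivative, because the relations among
  the slopes of \<open>m\<close>, T m and X m - x give the determinant and the formula for
  \<open>q\<close>.\<close>

lemma affine_if_partials_zero:
  assumes N: "open N" "convex N" and f: "smooth_on N f"
    and 0: "\<And>p. p \<in> N \<Longrightarrow> Pt (Pt f) p = 0" "\<And>p. p \<in> N \<Longrightarrow> Px f p = 0" "\<And>p. p \<in> N \<Longrightarrow> Pu f p = 0"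
  shows "\<exists>c d. \<forall>p\<in>N. f p = c * fst p + d \<and> Pt f p = c"
proof -
  note df = smooth_on_differentiable[OF f] smooth_on_differentiable[OF smooth_on_pd[OF f]]
  have "Px (Pt f) p = 0" "Pu (Pt f) p = 0" if "p \<in> N" for p
    using pd_commute[OF N(1) f that] pd_eq_zero[OF N(1) that, of "Px f" 0] pd_eq_zero[OF N(1) that, of "Pu f" 0] 0
    by simp_all
  then obtain c where c: "\<forall>p\<in>N. Pt f p = c"
    using constant_if_partials_zero[OF N df(2) 0(1)] by blast
  have l: "bounded_linear (\<lambda>p::real \<times> real \<times> real. c * fst p)"
    by (intro bounded_linear_mult_right[THEN bounded_linear_compose] bounded_linear_fst)
  have d: "(\<lambda>p::real \<times> real \<times> real. c * fst p) differentiable at p" for p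
    by (rule bounded_linear_imp_differentiable[OF l])
  have "\<exists>d. \<forall>p\<in>N. f p - c * fst p = d"
  proof (rule constant_if_partials_zero[OF N])
    fix p assume p: "p \<in> N"
    show "(\<lambda>p. f p - c * fst p) differentiable at p" by (intro differentiable_diff df p d)
    have pd: "pd v (\<lambda>p. f p - c * fst p) p = pd v f p - c * fst v" for v
      by (subst pd_diff[OF df(1)[OF p] d]) (simp only: pd_bounded_linear[OF l])
    show "Pt (\<lambda>p. f p - c * fst p) p = 0" "Px (\<lambda>p. f p - c * fst p) p = 0" "Pu (\<lambda>p. f p - c * fst p) p = 0"
      using c p pd by (simp_all add: 0)
  qed
  then show ?thesis using c by (metis diff_add_cancel add.commute)
qed

text \<open>For the exponent of the multiplier, where Y / M is the new space coordinate: the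
  derivative is written as a polynomial in this quotient.\<close>

lemma has_derivative_square_divide:
  fixes c :: real
  assumes "(Y has_derivative Y') (at p)" "(M has_derivative M') (at p)" "M p \<noteq> 0"
  shows "((\<lambda>p. c * (Y p)\<^sup>2 / (4 * M p)) has_derivative
    (\<lambda>v. c * (Y p / M p) * Y' v / 2 - c * (Y p / M p)\<^sup>2 * M' v / 4)) (at p)"
  by (rule derivative_eq_intros assms refl | simp add: assms)+
    (use assms(3) in \<open>simp add: fun_eq_iff field_simps power2_eq_square\<close>)

section \<open>Compatibility conditions of the determining equations\<close>

context heat_symmetry
begin

definition "m = (\<lambda>p. 1 / Px X p)"
text \<open>This is X_t / X_x, the first-order coefficient in U_xx = U_t - q U_x.\<close>

definition "q = (\<lambda>p. Pt X p * m p)"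
definition "A = Pu U"
definition "k = (\<lambda>p. U p / A p)"

lemma smooth_mqAk: "smooth_on \<Omega> m" "smooth_on \<Omega> q" "smooth_on \<Omega> A" "smooth_on \<Omega> k"
proof -
  show m: "smooth_on \<Omega> m"
    unfolding m_def by (intro smooth_on_intros open_\<Omega> smooth X_x_nonzero)
  show "smooth_on \<Omega> q"
    unfolding q_def by (intro smooth_on_intros open_\<Omega> smooth m)
  show "smooth_on \<Omega> A" "smooth_on \<Omega> k"
    unfolding A_def k_def by (intro smooth_on_intros open_\<Omega> smooth U_u_nonzero; assumption)+
qed

context
  fixes p assumes p: "p \<in> \<Omega>"
begin

lemma dif:
  "m differentiable at p" "q differentiable at p" "A differentiable at p" "k differentiable at p"
  "pd v m differentiable at p" "pd v q differentiable at p" "pd v A differentiable at p" "pd v k differentiable at p"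
  by (intro smooth_on_differentiable[OF _ p] smooth_on_intros smooth_mqAk open_\<Omega>; simp)+

lemma X_x_m: "Px X p * m p = 1"
  using X_x_nonzero[OF p] by (simp add: m_def)

lemma m_nonzero: "m p \<noteq> 0"
  using X_x_m by auto

end

lemma m_x: assumes p: "p \<in> \<Omega>" shows "Px m p = 0" "Pu m p = 0"
  by (simp_all add: m_def pd_divide X_xx differentiable p X_x_nonzero pd_const)

lemma m_tx: assumes p: "p \<in> \<Omega>" shows "Px (Pt m) p = 0"
  using pd_commute[OF open_\<Omega> smooth_mqAk(1) p, of "(0,1,0)" "(1,0,0)"] pd_eq_zero[OF open_\<Omega> p m_x(1)] by simp

lemma X_xt: assumes p: "p \<in> \<Omega>" shows "Pt (Px X) p = - (Px X p)\<^sup>2 * Pt m p"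
proof -
  have "Pt (\<lambda>p. Px X p * m p) p = 0"
    by (rule pd_eq_zero[OF open_\<Omega> p]) (simp add: X_x_m)
  then have "Pt (Px X) p * m p + Px X p * Pt m p = 0"
    by (simp add: pd_mult differentiable dif differentiable_divide p)
  with X_x_m[OF p] show ?thesis by algebra
qed

lemma q_x: assumes p: "p \<in> \<Omega>" shows "Px q p = - (Px X p * Pt m p)" "Pu q p = 0"
proof -
  have "Pu (Pt X) p = 0" "Px (Pt X) p = Pt (Px X) p"
    using pd_commute[OF open_\<Omega> smooth(2) p] pd_eq_zero[OF open_\<Omega> p X_u] by simp_all
  then show "Px q p = - (Px X p * Pt m p)" "Pu q p = 0"
    using X_x_m[OF p] X_xt[OF p]
    by (simp_all add: q_def pd_mult differentiable dif p m_x) algebra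
qed

lemma q_xx: assumes p: "p \<in> \<Omega>" shows "Px (Px q) p = 0"
proof -
  have "Px (Px q) p = Px (\<lambda>p. - (Px X p * Pt m p)) p"
    by (rule pd_cong[OF open_\<Omega> p]) (simp add: q_x)
  also have "\<dots> = 0"
    by (simp add: pd_minus pd_mult differentiable dif p X_xx m_tx)
  finally show ?thesis .
qed

lemma A_nonzero: "p \<in> \<Omega> \<Longrightarrow> A p \<noteq> 0"
  by (simp add: A_def U_u_nonzero)

lemma A_u: "p \<in> \<Omega> \<Longrightarrow> Pu A p = 0"
  by (simp add: A_def U_equations)

lemma A_x: assumes p: "p \<in> \<Omega>" shows "Px A p = - (A p * q p / 2)"
proof -
  have "Px A p = Pu (Px U) p"
    unfolding A_def by (rule pd_commute[OF open_\<Omega> smooth(3) p])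
  then have "2 * Px X p * Px A p = - (A p * Pt X p)"
    using U_equations(2)[OF p] by (simp add: A_def)
  then show ?thesis
    using X_x_m[OF p] unfolding q_def by algebra
qed

lemma A_xx: assumes p: "p \<in> \<Omega>" shows "Px (Px A) p = A p * (q p * q p / 4 - Px q p / 2)"
proof -
  have "Px (Px A) p = Px (\<lambda>p. - (A p * q p / 2)) p"
    by (rule pd_cong[OF open_\<Omega> p]) (simp add: A_x)
  also have "\<dots> = - (1 / 2) * (Px A p * q p + A p * Px q p)"
    by (simp add: pd_minus pd_divide pd_mult pd_const dif differentiable_divide p)
  finally show ?thesis by (simp add: A_x p field_simps)
qed

lemma U_xx: assumes p: "p \<in> \<Omega>" shows "Px (Px U) p = Pt U p - Px U p * q p"
  using U_equations(3)[OF p] X_x_m[OF p] unfolding q_def by algebra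

text \<open>The u-derivative of U_xx = U_t - q U_x shows that A = U_u satisfies the same equation;
  A_x = -A q / 2 then eliminates A_x and A_xx.\<close>

lemma A_t: assumes p: "p \<in> \<Omega>" shows "Pt A p = - (A p * (Px q p / 2 + q p * q p / 4))"
proof -
  have "Pu (Px (Px U)) p = Px (Pu (Px U)) p"
    by (rule pd_commute[OF open_\<Omega> smooth_on_pd[OF smooth(3)] p])
  also have "\<dots> = Px (Px A) p"
    unfolding A_def by (rule pd_cong[OF open_\<Omega> p pd_commute[OF open_\<Omega> smooth(3)]])
  finally have 1: "Pu (Px (Px U)) p = Px (Px A) p" .
  have 2: "Pu (Pt U) p = Pt A p" "Pu (Px U) p = Px A p"
    unfolding A_def by (rule pd_commute[OF open_\<Omega> smooth(3) p])+
  have d: "(\<lambda>p. Px U p * q p) differentiable at p"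
    by (intro differentiable_mult differentiable dif differentiable_divide p)
  have "Pu (Px (Px U)) p = Pu (\<lambda>p. Pt U p - Px U p * q p) p"
    by (rule pd_cong[OF open_\<Omega> p U_xx])
  also have "\<dots> = Pt A p - Px A p * q p"
    by (simp add: pd_diff pd_mult differentiable dif d p 2 q_x)
  finally show ?thesis unfolding 1 by (simp add: A_x A_xx p field_simps)
qed

text \<open>The formulas for A_x and A_t must satisfy A_tx = A_xt. This compatibility is q_t = q_xx
  + q q_x, and q_xx = 0.\<close>

lemma q_t: assumes p: "p \<in> \<Omega>" shows "Pt q p = q p * Px q p"
proof -
  have "Px (Pt A) p = Px (\<lambda>p. - (A p * (Px q p / 2 + q p * q p / 4))) p"
    by (rule pd_cong[OF open_\<Omega> p]) (simp add: A_t)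
  also have "\<dots> = - (Px A p * (Px q p / 2 + q p * q p / 4) + A p * (Px (Px q) p / 2 + 2 * q p * Px q p / 4))"
    by (simp add: pd_minus pd_mult pd_add pd_divide pd_const dif differentiable_divide p)
  finally have 1: "Px (Pt A) p = - (Px A p * (Px q p / 2 + q p * q p / 4) + A p * (Px (Px q) p / 2 + 2 * q p * Px q p / 4))" .
  have "Pt (Px A) p = Pt (\<lambda>p. - (A p * q p / 2)) p"
    by (rule pd_cong[OF open_\<Omega> p]) (simp add: A_x)
  also have "\<dots> = (- 1 / 2) * (Pt A p * q p + A p * Pt q p)"
    by (simp add: pd_minus pd_divide pd_mult pd_const dif differentiable_divide p)
  finally have "Px (Pt A) p = (- 1 / 2) * (Pt A p * q p + A p * Pt q p)"
    using pd_commute[OF open_\<Omega> smooth_mqAk(3) p, of "(0,1,0)" "(1,0,0)"] by simp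
  then have "A p * Pt q p = A p * (q p * Px q p)"
    unfolding 1 by (auto simp: A_x A_t q_xx p field_simps)
  then show ?thesis using A_nonzero[OF p] by simp
qed

text \<open>The x-derivative of q_t = q q_x is q_xt = q_x^2. Inserting q_x = -m_t / m cancels the
  squares and leaves m_tt / m = 0.\<close>

lemma m_tt: assumes p: "p \<in> \<Omega>" shows "Pt (Pt m) p = 0"
proof -
  have "Px (Pt q) p = Px (\<lambda>p. q p * Px q p) p"
    by (rule pd_cong[OF open_\<Omega> p q_t])
  also have "\<dots> = Px q p * Px q p"
    by (simp add: pd_mult dif p q_xx)
  finally have 1: "Px (Pt q) p = Px q p * Px q p" .
  have "Pt (Px q) p = Pt (\<lambda>p. - (Px X p * Pt m p)) p"
    by (rule pd_cong[OF open_\<Omega> p]) (simp add: q_x)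
  also have "\<dots> = - (Pt (Px X) p * Pt m p + Px X p * Pt (Pt m) p)"
    by (simp add: pd_minus pd_mult dif differentiable differentiable_divide p)
  finally have "Px X p * Pt (Pt m) p = 0"
    using 1 pd_commute[OF open_\<Omega> smooth_mqAk(2) p, of "(0,1,0)" "(1,0,0)"]
    by (simp add: q_x p X_xt power2_eq_square algebra_simps)
  then show ?thesis using X_x_nonzero[OF p] by simp
qed

text \<open>From T_t = X_x^2 and X_x m = 1 one gets T_t m = X_x. In the second t-derivative, X_xt =
  -X_x^2 m_t cancels T_t m_t, and m_tt = 0.\<close>

lemma Tm:
  assumes p: "p \<in> \<Omega>"
  shows "Px (\<lambda>p. T p * m p) p = 0" "Pu (\<lambda>p. T p * m p) p = 0"
    "Pt (\<lambda>p. T p * m p) p = Px X p + T p * Pt m p"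
    "Pt (Pt (\<lambda>p. T p * m p)) p = 0"
proof -
  have 1: "Pt (\<lambda>p. T p * m p) p = Px X p + T p * Pt m p" if p: "p \<in> \<Omega>" for p
    using X_x_m[OF p] by (simp add: pd_mult differentiable dif p T_t power2_eq_square)
  show "Pt (\<lambda>p. T p * m p) p = Px X p + T p * Pt m p" by (rule 1[OF p])
  have "Pt (Pt (\<lambda>p. T p * m p)) p = Pt (\<lambda>p. Px X p + T p * Pt m p) p"
    by (rule pd_cong[OF open_\<Omega> p 1])
  also have "\<dots> = Pt (Px X) p + Pt T p * Pt m p + T p * Pt (Pt m) p"
    by (simp add: pd_add pd_mult differentiable dif differentiable_divide p)
  finally show "Pt (Pt (\<lambda>p. T p * m p)) p = 0"
    by (simp add: X_xt T_t m_tt p)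
qed (simp_all add: pd_mult differentiable dif p T_x_T_u m_x)

text \<open>The second t-derivative is q_t + X_t m_t, and q_t = q q_x = -q X_x m_t = -X_t
  m_t.\<close>

lemma Xm:
  assumes p: "p \<in> \<Omega>"
  shows "Px (\<lambda>p. X p * m p - fst (snd p)) p = 0" "Pu (\<lambda>p. X p * m p - fst (snd p)) p = 0"
    "Pt (\<lambda>p. X p * m p - fst (snd p)) p = q p + X p * Pt m p"
    "Pt (Pt (\<lambda>p. X p * m p - fst (snd p))) p = 0"
proof -
  note bl = bounded_linear_compose[OF bounded_linear_fst bounded_linear_snd]
  have pd: "pd v (\<lambda>p. X p * m p - fst (snd p)) p = pd v X p * m p + X p * pd v m p - fst (snd v)"
    if p: "p \<in> \<Omega>" for p v
    by (simp add: pd_diff pd_mult differentiable dif p bounded_linear_imp_differentiable[OF bl] pd_bounded_linear[OF bl])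
  show "Px (\<lambda>p. X p * m p - fst (snd p)) p = 0" "Pu (\<lambda>p. X p * m p - fst (snd p)) p = 0"
    by (simp_all add: pd p X_x_m m_x X_u)
  have 1: "Pt (\<lambda>p. X p * m p - fst (snd p)) p = q p + X p * Pt m p" if p: "p \<in> \<Omega>" for p
    by (simp add: pd p q_def)
  show "Pt (\<lambda>p. X p * m p - fst (snd p)) p = q p + X p * Pt m p" by (rule 1[OF p])
  have "Pt (Pt (\<lambda>p. X p * m p - fst (snd p))) p = Pt (\<lambda>p. q p + X p * Pt m p) p"
    by (rule pd_cong[OF open_\<Omega> p 1])
  also have "\<dots> = Pt q p + Pt X p * Pt m p"
    by (simp add: pd_add pd_mult differentiable dif p m_tt)
  also have "\<dots> = 0"
    using X_x_m[OF p] unfolding q_t[OF p] q_x(1)[OF p] unfolding q_def by algebra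
  finally show "Pt (Pt (\<lambda>p. X p * m p - fst (snd p))) p = 0" .
qed

lemma k_u: "p \<in> \<Omega> \<Longrightarrow> Pu k p = 1"
  using A_nonzero[of p] by (simp add: k_def pd_divide differentiable dif A_u) (simp add: A_def)

text \<open>Substituting U = A k into U_xx = U_t - q U_x: the terms in k_x cancel because 2 A_x = -q
  A, and the terms in k cancel because A solves the same equation.\<close>

lemma k_heat: assumes p: "p \<in> \<Omega>" shows "Pt k p = Px (Px k) p"
proof -
  have U: "U p = A p * k p" if "p \<in> \<Omega>" for p
    using A_nonzero[OF that] by (simp add: k_def)
  have pdU: "pd v U p = pd v A p * k p + A p * pd v k p" if p: "p \<in> \<Omega>" for p v
    using pd_cong[OF open_\<Omega> p U] by (simp add: pd_mult dif differentiable_divide p)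
  have "Px (Px U) p = Px (\<lambda>p. Px A p * k p + A p * Px k p) p"
    by (rule pd_cong[OF open_\<Omega> p pdU])
  also have "\<dots> = Px (Px A) p * k p + 2 * Px A p * Px k p + A p * Px (Px k) p"
    by (simp add: pd_add pd_mult dif differentiable_divide p)
  finally have "A p * Pt k p = A p * Px (Px k) p"
    unfolding U_xx[OF p] pdU[OF p] by (simp add: A_xx A_x A_t p field_simps)
  then show ?thesis using A_nonzero[OF p] by simp
qed

lemma local_form:
  assumes p0: "p0 \<in> \<Omega>"
  shows "\<exists>N \<alpha> \<beta> \<gamma> \<delta> l1 l0 \<sigma> D h. open N \<and> p0 \<in> N \<and> N \<subseteq> \<Omega> \<and>
    \<alpha> * \<delta> - \<beta> * \<gamma> = 1 \<and> \<sigma> \<noteq> 0 \<and> heat_solution D h \<and>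
    (\<forall>(t, x, u)\<in>N. (t, x) \<in> D \<and> \<gamma> * t + \<delta> \<noteq> 0 \<and>
      (T (t, x, u), X (t, x, u), U (t, x, u)) = heat_symmetry_form \<alpha> \<beta> \<gamma> \<delta> l1 l0 \<sigma> h (t, x, u))"
proof -
  obtain t0 x0 u0 where p0_eq: "p0 = (t0, x0, u0)" by (cases p0)
  \<comment> \<open>A box: it is convex, so vanishing partial derivatives force constants; it
    projects onto an open D; and vertical segments to the level u0 stay inside. The radius e / 3
    works since the distance is at most the sum of the three coordinate distances.\<close>
  obtain r where r: "r > 0" "ball t0 r \<times> ball x0 r \<times> ball u0 r \<subseteq> \<Omega>"
  proof -
    obtain e where e: "e > 0" "ball p0 e \<subseteq> \<Omega>" using openE[OF open_\<Omega> p0] .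
    have "dist (t0, x0, u0) (t, x, u) \<le> dist t0 t + (dist x0 x + dist u0 u)" for t x u
      using sqrt_sum_squares_le_sum[of "dist t0 t" "dist (x0, u0) (x, u)"]
        sqrt_sum_squares_le_sum[of "dist x0 x" "dist u0 u"]
      by (simp add: dist_Pair_Pair)
    from le_less_trans[OF this] have "ball t0 (e/3) \<times> ball x0 (e/3) \<times> ball u0 (e/3) \<subseteq> ball p0 e"
      unfolding p0_eq by auto
    with e that[of "e/3"] show ?thesis by auto
  qed
  define D where "D = ball t0 r \<times> ball x0 r"
  define N where "N = ball t0 r \<times> ball x0 r \<times> ball u0 r"
  have N: "open N" "convex N" "N \<subseteq> \<Omega>" "p0 \<in> N" and D: "open D"
    using r by (auto simp: N_def D_def p0_eq intro!: open_Times convex_Times)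
  have N\<Omega>: "p \<in> N \<Longrightarrow> p \<in> \<Omega>" for p using N(3) by auto
  have sT: "smooth_on N (\<lambda>p. T p * m p)" and sX: "smooth_on N (\<lambda>p. X p * m p - fst (snd p))"
    and sm: "smooth_on N m"
    by (rule smooth_on_subset[OF _ N(3)], intro smooth_on_intros smooth smooth_mqAk open_\<Omega>)+
  obtain \<gamma> \<delta> where mN: "\<And>p. p \<in> N \<Longrightarrow> m p = \<gamma> * fst p + \<delta> \<and> Pt m p = \<gamma>"
    using affine_if_partials_zero[OF N(1,2) sm m_tt m_x, OF N\<Omega> N\<Omega> N\<Omega>] by auto
  obtain \<alpha> \<beta> where TN: "\<And>p. p \<in> N \<Longrightarrow> T p * m p = \<alpha> * fst p + \<beta> \<and> Pt (\<lambda>p. T p * m p) p = \<alpha>"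
    using affine_if_partials_zero[OF N(1,2) sT Tm(4,1,2), OF N\<Omega> N\<Omega> N\<Omega>] by auto
  obtain l1 l0 where XN: "\<And>p. p \<in> N \<Longrightarrow> X p * m p - fst (snd p) = l1 * fst p + l0 \<and>
      Pt (\<lambda>p. X p * m p - fst (snd p)) p = l1"
    using affine_if_partials_zero[OF N(1,2) sX Xm(4,1,2), OF N\<Omega> N\<Omega> N\<Omega>] by auto
  have mnz: "\<gamma> * fst p + \<delta> \<noteq> 0" if "p \<in> N" for p
    using mN[OF that] m_nonzero[OF N\<Omega>[OF that]] by simp
  have q: "q p = l1 - \<gamma> * (fst (snd p) + l1 * fst p + l0) / (\<gamma> * fst p + \<delta>)" if "p \<in> N" for p
  proof -
    have "q p = l1 - \<gamma> * X p"
      using XN[OF that] Xm(3)[OF N\<Omega>[OF that]] mN[OF that] by (auto simp: algebra_simps)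
    moreover have "X p * (\<gamma> * fst p + \<delta>) = fst (snd p) + l1 * fst p + l0"
      using XN[OF that] mN[OF that] by simp
    ultimately show ?thesis using mnz[OF that] by (metis nonzero_eq_divide_eq times_divide_eq_right)
  qed
  have det: "\<alpha> * \<delta> - \<beta> * \<gamma> = 1"
  proof -
    \<comment> \<open>The slope of T m equals X_x + T m_t; multiplied by m this is the Wronskian
      identity for m and T m.\<close>
    have "\<alpha> = Px X p0 + T p0 * \<gamma>" using TN[OF N(4)] Tm(3)[OF p0] mN[OF N(4)] by simp
    then have "\<alpha> * m p0 = 1 + T p0 * m p0 * \<gamma>" using X_x_m[OF p0] by algebra
    then have "\<alpha> * (\<gamma> * fst p0 + \<delta>) = 1 + (\<alpha> * fst p0 + \<beta>) * \<gamma>"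
      using TN[OF N(4)] mN[OF N(4)] by simp
    then show ?thesis by algebra
  qed
  define Q where "Q p = \<gamma> * (fst (snd p) + l1 * fst p + l0)\<^sup>2 / (4 * (\<gamma> * fst p + \<delta>)) - l1 / 2 * fst (snd p)
    - l1\<^sup>2 / 4 * fst p" for p :: "real \<times> real \<times> real"
  define A0 where "A0 p = sqrt \<bar>\<gamma> * fst p + \<delta>\<bar> * exp (Q p)" for p
  have A0nz: "A0 p \<noteq> 0" if "p \<in> N" for p using mnz[OF that] by (simp add: A0_def)
  \<comment> \<open>The bracket is the logarithmic differential of A: q_x = -\<gamma> / m turns
    -(q_x / 2 + q^2 / 4) into \<gamma> / (2 m) - q^2 / 4. Hence A / A0 is constant, and the constant
    is \<sigma>.\<close>
  have dA0: "(A0 has_derivative (\<lambda>v. A0 p * (fst v * (\<gamma> / (2 * m p) - q p * q p / 4) - fst (snd v) * q p / 2))) (at p)"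
    if pN: "p \<in> N" for p
  proof -
    have 1: "((\<lambda>p. \<gamma> * fst p + \<delta>) has_derivative (\<lambda>v. \<gamma> * fst v)) (at p)"
      by (auto intro!: derivative_eq_intros)
    have 2: "(Q has_derivative (\<lambda>v. - (fst v * (q p * q p / 4)) - fst (snd v) * q p / 2)) (at p)"
    proof -
      define s where "s = (fst (snd p) + l1 * fst p + l0) / (\<gamma> * fst p + \<delta>)"
      \<comment> \<open>Here s is the value of X, so the differential of the exponent becomes a
        polynomial identity in s.\<close>
      have qs: "q p = l1 - \<gamma> * s" using q[OF pN] by (simp add: s_def)
      have 3: "((\<lambda>p. fst (snd p) + l1 * fst p + l0) has_derivative (\<lambda>v. fst (snd v) + l1 * fst v)) (at p)"
        by (auto intro!: derivative_eq_intros)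
      have 4: "((\<lambda>p. l1 / 2 * fst (snd p)) has_derivative (\<lambda>v. l1 / 2 * fst (snd v))) (at p)"
        "((\<lambda>p. l1\<^sup>2 / 4 * fst p) has_derivative (\<lambda>v. l1\<^sup>2 / 4 * fst v)) (at p)"
        by (auto intro!: derivative_eq_intros)
      show ?thesis
        unfolding Q_def
        by (rule has_derivative_eq_rhs[OF has_derivative_diff[OF has_derivative_diff[OF
            has_derivative_square_divide[OF 3 1 mnz[OF pN]] 4(1)] 4(2)]])
          (simp only: qs s_def[symmetric], simp add: fun_eq_iff field_simps power2_eq_square)
    qed
    show ?thesis
      unfolding A0_def
      by (rule has_derivative_eq_rhs[OF has_derivative_mult[OF has_derivative_sqrt_abs[OF 1 mnz[OF pN]] has_derivative_exp[OF 2]]])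
        (simp add: mN[OF pN] fun_eq_iff algebra_simps)
  qed
  have "\<exists>\<sigma>. \<forall>p\<in>N. A p / A0 p = \<sigma>"
  proof (rule constant_if_partials_zero[OF N(1,2)])
    fix p assume pN: "p \<in> N"
    note p = N\<Omega>[OF pN]
    have dd: "A0 differentiable at p" using dA0[OF pN] by (rule differentiableI)
    show "(\<lambda>p. A p / A0 p) differentiable at p"
      by (intro differentiable_divide dif p dd A0nz pN)
    have "Px q p = - (\<gamma> / m p)"
      using q_x(1)[OF p] X_x_m[OF p] mN[OF pN] m_nonzero[OF p] by (simp add: field_simps)
    then show "Pt (\<lambda>p. A p / A0 p) p = 0" "Px (\<lambda>p. A p / A0 p) p = 0" "Pu (\<lambda>p. A p / A0 p) p = 0"
      by (simp_all add: pd_divide dif p dd A0nz pN pd_eqI[OF dA0[OF pN]] A_t A_x A_u algebra_simps)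
  qed
  then obtain \<sigma> where \<sigma>: "\<And>p. p \<in> N \<Longrightarrow> A p = \<sigma> * A0 p"
    using A0nz by (metis nonzero_eq_divide_eq)
  have \<sigma>nz: "\<sigma> \<noteq> 0" using \<sigma>[OF N(4)] A_nonzero[OF p0] by auto
  \<comment> \<open>On each vertical segment k - u is constant because k_u = 1, so its value at the
    level u0 determines it.\<close>
  define h where "h = (\<lambda>r. k (fst r, snd r, u0) - u0)"
  have g: "\<forall>r\<in>D. (fst r, snd r, u0) \<in> \<Omega>"
    using N(3) r(1) by (auto simp: D_def N_def)
  note const = smooth_on_const[OF D, of u0]
  \<comment> \<open>The level u = u0 is the graph of a constant function, so the rules for
    derivatives along graphs apply.\<close>
  have sk: "smooth_on D (\<lambda>r. k (fst r, snd r, u0))"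
    by (rule smooth_on_graph[OF open_\<Omega> smooth_mqAk(4) D const g])
  have "heat_solution D (\<lambda>r. k (fst r, snd r, u0))"
    unfolding heat_solution_iff_pd
  proof (intro conjI ballI D sk)
    fix r assume rD: "r \<in> D"
    have "px (\<lambda>_. u0) = (\<lambda>_. 0)" by (simp add: fun_eq_iff pd_const)
    then show "pt (\<lambda>r. k (fst r, snd r, u0)) r = px (px (\<lambda>r. k (fst r, snd r, u0))) r"
      using pd_graph[OF open_\<Omega> smooth_mqAk(4) D const g rD]
        pd2_graph(3)[OF open_\<Omega> smooth_mqAk(4) D const g rD] k_heat g rD
      by (simp add: pd_const)
  qed
  then have Dh: "heat_solution D h"
    unfolding h_def heat_solution_iff_pd
  proof (intro conjI ballI D; elim conjE)
    show "smooth_on D (\<lambda>r. k (fst r, snd r, u0) - u0)" by (intro smooth_on_diff D sk const)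
    fix r assume rD: "r \<in> D"
    have 1: "pd v (\<lambda>r. k (fst r, snd r, u0) - u0) r = pd v (\<lambda>r. k (fst r, snd r, u0)) r" if "r \<in> D" for v r
      by (simp add: pd_diff smooth_on_differentiable[OF sk that] pd_const)
    have "pd w (pd v (\<lambda>r. k (fst r, snd r, u0) - u0)) r = pd w (pd v (\<lambda>r. k (fst r, snd r, u0))) r" for v w
      by (rule pd_cong[OF D rD 1])
    moreover assume "\<forall>q\<in>D. pt (\<lambda>r. k (fst r, snd r, u0)) q = px (px (\<lambda>r. k (fst r, snd r, u0))) q"
    ultimately show "pt (\<lambda>r. k (fst r, snd r, u0) - u0) r = px (px (\<lambda>r. k (fst r, snd r, u0) - u0)) r"
      using rD by (simp add: 1)
  qed
  have form: "(t, x) \<in> D \<and> \<gamma> * t + \<delta> \<noteq> 0 \<and>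
      (T (t, x, u), X (t, x, u), U (t, x, u)) = heat_symmetry_form \<alpha> \<beta> \<gamma> \<delta> l1 l0 \<sigma> h (t, x, u)"
    if pN: "(t, x, u) \<in> N" for t x u
  proof -
    have tx: "t \<in> ball t0 r" "x \<in> ball x0 r" "u \<in> ball u0 r" using pN by (auto simp: N_def)
    have "\<exists>c. \<forall>s\<in>ball u0 r. k (t, x, s) - s = c"
    proof (rule has_field_derivative_zero_constant)
      fix s assume "s \<in> ball u0 r"
      then have s: "(t, x, s) \<in> \<Omega>" using tx N\<Omega> by (auto simp: N_def)
      have "((\<lambda>s. k (t, x, s)) has_derivative (\<lambda>v. v)) (at s)"
        using has_derivative_compose_3[OF has_derivative_const has_derivative_const has_derivative_ident, of k t x s]
          dif(4)[OF s] by (simp add: k_u s)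
      from has_derivative_diff[OF this has_derivative_ident]
      show "((\<lambda>s. k (t, x, s) - s) has_real_derivative 0) (at s within ball u0 r)"
        by (auto simp: has_field_derivative_def lambda_zero intro: has_derivative_at_withinI)
    qed simp
    then have "k (t, x, u) - u = k (t, x, u0) - u0" using tx(3) r(1) by auto
    then have "k (t, x, u) = u + h (t, x)" by (simp add: h_def)
    then have "U (t, x, u) = A (t, x, u) * (u + h (t, x))"
      using A_nonzero[OF N\<Omega>[OF pN]] by (simp add: k_def field_simps)
    then show ?thesis
      using tx mnz[OF pN] mN[OF pN] TN[OF pN] XN[OF pN] \<sigma>[OF pN]
      by (auto simp: D_def heat_symmetry_form_def A0_def Q_def field_simps)
  qed
  show ?thesis
  proof (intro exI conjI)
    show "\<forall>(t, x, u)\<in>N. (t, x) \<in> D \<and> \<gamma> * t + \<delta> \<noteq> 0 \<and>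
      (T (t, x, u), X (t, x, u), U (t, x, u)) = heat_symmetry_form \<alpha> \<beta> \<gamma> \<delta> l1 l0 \<sigma> h (t, x, u)"
      using form by blast
  qed (fact N det \<sigma>nz Dh)+
qed

end

section \<open>Transformations of the given form are symmetries\<close>

locale heat_form =
  fixes \<alpha> \<beta> \<gamma> \<delta> l1 l0 \<sigma> :: real
  assumes det: "\<alpha> * \<delta> - \<beta> * \<gamma> = 1" and \<sigma>: "\<sigma> \<noteq> 0"
begin

definition "den q = \<gamma> * fst q + \<delta>" for q :: "real \<times> real"
definition "F q = ((\<alpha> * fst q + \<beta>) / den q, (snd q + l1 * fst q + l0) / den q)" for q
definition "\<mu> q = \<sigma> * sqrt \<bar>den q\<bar> *
  exp (\<gamma> * (snd q + l1 * fst q + l0)\<^sup>2 / (4 * den q) - l1 / 2 * snd q - l1\<^sup>2 / 4 * fst q)" for q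

text \<open>For the new variables (s, y) = F(t, x) the determinant condition gives (\<alpha> -
  \<gamma> s)(\<gamma> t + \<delta>) = 1. Thus \<open>n\<close> is \<open>den\<close> in the new
  variables, (\<tau>, \<xi>) is the inverse of \<open>F\<close>, \<open>E0\<close> is its domain and
  \<open>B\<close> is the multiplier \<open>\<mu>\<close>. With these formulas the transformed
  function is explicit and can be differentiated directly.\<close>

definition E0 :: "(real \<times> real) set" where "E0 = {r. \<alpha> - \<gamma> * fst r \<noteq> 0}"
definition "n r = 1 / (\<alpha> - \<gamma> * fst r)" for r :: "real \<times> real"
definition "\<tau> r = (\<delta> * fst r - \<beta>) * n r" for r
definition "\<xi> r = snd r * n r - l1 * \<tau> r - l0" for r
definition "B r = \<sigma> * sqrt \<bar>n r\<bar> * exp (\<gamma> / 4 * (snd r * snd r) * n r - l1 / 2 * \<xi> r - l1\<^sup>2 / 4 * \<tau> r)" for r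

lemma heat_symmetry_form_eq:
  "heat_symmetry_form \<alpha> \<beta> \<gamma> \<delta> l1 l0 \<sigma> h (fst q, snd q, u) = (fst (F q), snd (F q), \<mu> q * (u + h q))"
  by (simp add: heat_symmetry_form_def F_def \<mu>_def den_def)

lemma F_image:
  assumes "den q \<noteq> 0"
  shows "F q \<in> E0" "n (F q) = den q" "\<tau> (F q) = fst q" "\<xi> (F q) = snd q" "B (F q) = \<mu> q"
proof -
  have e: "(\<alpha> - \<gamma> * fst (F q)) * den q = 1"
    using assms det by (simp add: F_def left_diff_distrib) (simp add: den_def algebra_simps)
  then show "F q \<in> E0" by (auto simp: E0_def)
  show n: "n (F q) = den q" using e assms by (simp add: n_def nonzero_eq_divide_eq mult.commute divide_eq_eq) auto
  have "fst (F q) * den q = \<alpha> * fst q + \<beta>" using assms by (simp add: F_def)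
  then have "\<tau> (F q) = \<delta> * (\<alpha> * fst q + \<beta>) - \<beta> * den q"
    unfolding \<tau>_def n by (simp add: algebra_simps)
  then show \<tau>: "\<tau> (F q) = fst q" unfolding den_def using det by algebra
  have "snd (F q) * den q = snd q + l1 * fst q + l0" using assms by (simp add: F_def)
  then show \<xi>: "\<xi> (F q) = snd q" by (simp add: \<xi>_def n \<tau>)
  have "\<gamma> / 4 * (snd (F q) * snd (F q)) * den q = \<gamma> * (snd q + l1 * fst q + l0)\<^sup>2 / (4 * den q)"
    using assms by (simp add: F_def power2_eq_square)
  then show "B (F q) = \<mu> q" unfolding B_def \<mu>_def n \<tau> \<xi> by simp
qed

lemma F_inverse:
  assumes "r \<in> E0"
  shows "den (\<tau> r, \<xi> r) \<noteq> 0" "F (\<tau> r, \<xi> r) = r"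
proof -
  have nz: "n r \<noteq> 0" and e: "n r * (\<alpha> - \<gamma> * fst r) = 1" using assms by (auto simp: E0_def n_def)
  have d: "den (\<tau> r, \<xi> r) = n r"
    unfolding den_def \<tau>_def fst_conv using e det by algebra
  then show "den (\<tau> r, \<xi> r) \<noteq> 0" using nz by simp
  have "\<alpha> * \<tau> r + \<beta> = fst r * n r" unfolding \<tau>_def using e det by algebra
  then show "F (\<tau> r, \<xi> r) = r"
    using nz by (simp add: F_def d prod_eq_iff) (simp add: \<xi>_def)
qed

lemma open_E0: "open E0"
  unfolding E0_def by (intro open_Collect_neq continuous_intros)

lemma smooth_n: "smooth_on E0 n" and smooth_\<tau>: "smooth_on E0 \<tau>" and smooth_\<xi>: "smooth_on E0 \<xi>"
proof -
  show n: "smooth_on E0 n"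
    unfolding n_def by (intro smooth_on_intros open_E0) (simp add: E0_def)
  show \<tau>: "smooth_on E0 \<tau>"
    unfolding \<tau>_def by (intro smooth_on_intros open_E0 n)
  show "smooth_on E0 \<xi>"
    unfolding \<xi>_def by (intro smooth_on_intros open_E0 n \<tau>)
qed

lemma n_nonzero: "r \<in> E0 \<Longrightarrow> n r \<noteq> 0"
  by (simp add: E0_def n_def)

lemma B_nonzero: "r \<in> E0 \<Longrightarrow> B r \<noteq> 0"
  by (simp add: B_def n_nonzero \<sigma>)

lemma smooth_B: "smooth_on E0 B"
  unfolding B_def
  by (intro smooth_on_intros smooth_on_sqrt_abs smooth_on_exp open_E0 smooth_n smooth_\<tau> smooth_\<xi> n_nonzero) auto

context
  fixes r assumes r: "r \<in> E0"
begin

lemma has_derivative_n: "(n has_derivative (\<lambda>v. \<gamma> * (n r)\<^sup>2 * fst v)) (at r)"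
proof -
  have nz: "\<alpha> - \<gamma> * fst r \<noteq> 0" using r by (simp add: E0_def)
  have "((\<lambda>r. \<alpha> - \<gamma> * fst r) has_derivative (\<lambda>v. - (\<gamma> * fst v))) (at r)"
    by (auto intro!: derivative_eq_intros)
  from has_derivative_divide'[OF has_derivative_const this nz, of 1]
  show ?thesis
    unfolding n_def by (rule has_derivative_eq_rhs) (simp add: fun_eq_iff power2_eq_square)
qed

lemma has_derivative_\<tau>: "(\<tau> has_derivative (\<lambda>v. (n r)\<^sup>2 * fst v)) (at r)"
proof -
  have e: "n r * (\<alpha> - \<gamma> * fst r) = 1" using r by (auto simp: E0_def n_def)
  have 1: "((\<lambda>r. \<delta> * fst r - \<beta>) has_derivative (\<lambda>v. \<delta> * fst v)) (at r)"
    by (auto intro!: derivative_eq_intros)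
  have "(\<delta> * fst r - \<beta>) * (\<gamma> * (n r)\<^sup>2) + \<delta> * n r = (n r)\<^sup>2" using e det by algebra
  then have "(\<delta> * fst r - \<beta>) * (\<gamma> * (n r)\<^sup>2 * fst v) + \<delta> * fst v * n r = (n r)\<^sup>2 * fst v"
    for v :: "real \<times> real" by algebra
  then show ?thesis
    using has_derivative_mult[OF 1 has_derivative_n] unfolding \<tau>_def by simp
qed

lemma has_derivative_\<xi>:
  "(\<xi> has_derivative (\<lambda>v. (\<gamma> * snd r - l1) * (n r)\<^sup>2 * fst v + n r * snd v)) (at r)"
  unfolding \<xi>_def
  by (rule has_derivative_eq_rhs, rule has_derivative_diff[OF has_derivative_diff[OF
      has_derivative_mult[OF has_derivative_snd[OF has_derivative_ident] has_derivative_n]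
      has_derivative_mult[OF has_derivative_const has_derivative_\<tau>]] has_derivative_const])
    (simp add: fun_eq_iff algebra_simps)

text \<open>Put b = (\<gamma> y - \<lambda>1) n / 2 with \<lambda>1 = \<open>l1\<close>. Then B_y =
  B b and B_s = B (\<gamma> n / 2 + b^2), while b_y = \<gamma> n / 2; so B is itself a heat
  solution, the image of the constant 1.\<close>

lemma has_derivative_B:
  "(B has_derivative (\<lambda>v. B r * ((\<gamma> * n r / 2 + ((\<gamma> * snd r - l1) * n r / 2)\<^sup>2) * fst v
    + (\<gamma> * snd r - l1) * n r / 2 * snd v))) (at r)"
proof -
  have 1: "((\<lambda>r. \<gamma> / 4 * (snd r * snd r)) has_derivative (\<lambda>v. \<gamma> / 2 * snd r * snd v)) (at r)"
    by (auto intro!: derivative_eq_intros)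
  have 2: "((\<lambda>r. \<gamma> / 4 * (snd r * snd r) * n r - l1 / 2 * \<xi> r - l1\<^sup>2 / 4 * \<tau> r) has_derivative
    (\<lambda>v. ((\<gamma> * snd r - l1) * n r / 2)\<^sup>2 * fst v + (\<gamma> * snd r - l1) * n r / 2 * snd v)) (at r)"
    by (rule has_derivative_eq_rhs, rule has_derivative_diff[OF has_derivative_diff[OF
        has_derivative_mult[OF 1 has_derivative_n]
        has_derivative_mult[OF has_derivative_const has_derivative_\<xi>]]
        has_derivative_mult[OF has_derivative_const has_derivative_\<tau>]])
      (simp add: fun_eq_iff power2_eq_square field_simps)
  show ?thesis
    unfolding B_def
    by (rule has_derivative_eq_rhs, rule has_derivative_mult[OF has_derivative_mult[OF has_derivative_const
        has_derivative_sqrt_abs[OF has_derivative_n n_nonzero[OF r]]] has_derivative_exp[OF 2]])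
      (simp add: fun_eq_iff power2_eq_square algebra_simps n_nonzero[OF r])
qed

lemma pd_ncoeffs:
  "pt n r = \<gamma> * (n r)\<^sup>2" "px n r = 0" "pt \<tau> r = (n r)\<^sup>2" "px \<tau> r = 0"
  "pt \<xi> r = (\<gamma> * snd r - l1) * (n r)\<^sup>2" "px \<xi> r = n r"
  "pt B r = B r * (\<gamma> * n r / 2 + ((\<gamma> * snd r - l1) * n r / 2)\<^sup>2)"
  "px B r = B r * ((\<gamma> * snd r - l1) * n r / 2)"
  by (simp_all add: pd_eqI[OF has_derivative_n] pd_eqI[OF has_derivative_\<tau>] pd_eqI[OF has_derivative_\<xi>]
      pd_eqI[OF has_derivative_B])

end

text \<open>Since B solves the heat equation, only derivatives of w remain to be compared. The
  second-order terms agree because \<tau>_s = n^2 = \<xi>_y^2 and w_t = w_xx; the first-order terms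
  agree because \<xi>_s = 2 b n, which matches the cross term 2 B_y \<xi>_y.\<close>

lemma transformed_heat_solution:
  assumes w: "heat_solution D w"
  shows "heat_solution (E0 \<inter> {r. (\<tau> r, \<xi> r) \<in> D}) (\<lambda>r. B r * w (\<tau> r, \<xi> r))"
proof -
  define E where "E = E0 \<inter> {r. (\<tau> r, \<xi> r) \<in> D}"
  have D: "open D" and sw: "smooth_on D w" and heat: "\<And>q. q \<in> D \<Longrightarrow> pt w q = px (px w) q"
    using w by (auto simp: heat_solution_iff_pd)
  have "continuous_on E0 (\<lambda>r. (\<tau> r, \<xi> r))"
    by (intro smooth_on_continuous_on smooth_on_intros open_E0 smooth_\<tau> smooth_\<xi>)
  then have E: "open E"
    using continuous_open_preimage[OF _ open_E0 D] by (simp add: E_def vimage_def)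
  have EE: "E \<subseteq> E0" by (auto simp: E_def)
  have ED: "(\<tau> r, \<xi> r) \<in> D" if "r \<in> E" for r using that by (simp add: E_def)
  note sm = smooth_on_subset[OF smooth_n EE] smooth_on_subset[OF smooth_\<tau> EE] smooth_on_subset[OF smooth_\<xi> EE]
    smooth_on_subset[OF smooth_B EE]
  have scomp: "smooth_on E (\<lambda>r. k (\<tau> r, \<xi> r))" if "smooth_on D k" for k :: "real \<times> real \<Rightarrow> real"
    by (intro smooth_on_compose[OF E D that] smooth_on_intros E sm ED)
  have sg: "smooth_on E (\<lambda>r. B r * w (\<tau> r, \<xi> r))"
    by (intro smooth_on_mult E sm scomp sw)
  define b where "b r = (\<gamma> * snd r - l1) * n r / 2" for r :: "real \<times> real"
  have sb: "smooth_on E b" unfolding b_def by (intro smooth_on_intros E sm) auto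
  note d = smooth_on_differentiable[OF sm(1)] smooth_on_differentiable[OF sm(2)] smooth_on_differentiable[OF sm(3)]
    smooth_on_differentiable[OF sm(4)] smooth_on_differentiable[OF sb] smooth_on_differentiable[OF scomp[OF sw]]
    smooth_on_differentiable[OF scomp[OF smooth_on_pd[OF sw]]]
    smooth_on_differentiable[OF sw ED] smooth_on_differentiable[OF smooth_on_pd[OF sw] ED]
  have pdk: "pt (\<lambda>r. k (\<tau> r, \<xi> r)) r = (n r)\<^sup>2 * pt k (\<tau> r, \<xi> r) + 2 * b r * n r * px k (\<tau> r, \<xi> r)"
    "px (\<lambda>r. k (\<tau> r, \<xi> r)) r = n r * px k (\<tau> r, \<xi> r)"
    if "r \<in> E" "k differentiable (at (\<tau> r, \<xi> r))" for k r
    using pd_compose_2[OF d(2)[OF that(1)] d(3)[OF that(1)] that(2)]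
    by (simp_all add: pd_ncoeffs[OF subsetD[OF EE that(1)]] b_def power2_eq_square)
  have pxb: "px b r = \<gamma> * n r / 2" if "r \<in> E" for r
  proof -
    have "(b has_derivative (\<lambda>v. (\<gamma> * snd r - l1) / 2 * (\<gamma> * (n r)\<^sup>2 * fst v) + \<gamma> / 2 * snd v * n r)) (at r)"
    proof -
      have 1: "((\<lambda>r. (\<gamma> * snd r - l1) / 2) has_derivative (\<lambda>v. \<gamma> / 2 * snd v)) (at r)"
        by (auto intro!: derivative_eq_intros)
      have "r \<in> E0" using that EE by blast
      from has_derivative_mult[OF 1 has_derivative_n[OF this]] show ?thesis
        by (simp add: b_def[abs_def])
    qed
    from pd_eqI[OF this] show ?thesis by simp
  qed
  have px: "px (\<lambda>r. B r * w (\<tau> r, \<xi> r)) r = B r * (b r * w (\<tau> r, \<xi> r) + n r * px w (\<tau> r, \<xi> r))"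
    if "r \<in> E" for r
    using that by (simp add: pd_mult d pdk pd_ncoeffs[OF subsetD[OF EE]] b_def algebra_simps)
  have pxx: "px (px (\<lambda>r. B r * w (\<tau> r, \<xi> r))) r =
    B r * b r * (b r * w (\<tau> r, \<xi> r) + n r * px w (\<tau> r, \<xi> r)) +
    B r * (\<gamma> * n r / 2 * w (\<tau> r, \<xi> r) + b r * (n r * px w (\<tau> r, \<xi> r)) + n r * (n r * px (px w) (\<tau> r, \<xi> r)))"
    if "r \<in> E" for r
    using that pd_cong[OF E that px]
    by (simp add: pd_mult pd_add d pdk pd_ncoeffs[OF subsetD[OF EE]] pxb) (simp add: b_def)
  have "pt (\<lambda>r. B r * w (\<tau> r, \<xi> r)) r = px (px (\<lambda>r. B r * w (\<tau> r, \<xi> r))) r" if "r \<in> E" for r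
    using that unfolding pxx[OF that]
    by (simp add: pd_mult d pdk pd_ncoeffs[OF subsetD[OF EE]] heat ED) (simp add: b_def power2_eq_square field_simps)
  then show ?thesis
    unfolding E_def[symmetric] by (simp add: heat_solution_iff_pd E sg)
qed

section \<open>The transformation on its natural domain\<close>

context
  fixes D :: "(real \<times> real) set" and h :: "real \<times> real \<Rightarrow> real"
    and \<Omega> :: "(real \<times> real \<times> real) set" and \<Phi> :: "real \<times> real \<times> real \<Rightarrow> real \<times> real \<times> real"
  assumes h: "heat_solution D h"
  defines "\<Omega> \<equiv> {(t, x, u). (t, x) \<in> D \<and> \<gamma> * t + \<delta> \<noteq> 0}"
    and "\<Phi> \<equiv> heat_symmetry_form \<alpha> \<beta> \<gamma> \<delta> l1 l0 \<sigma> h"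
begin

lemma mem_\<Omega>: "(fst q, snd q, u) \<in> \<Omega> \<longleftrightarrow> q \<in> D \<and> den q \<noteq> 0"
  by (simp add: \<Omega>_def den_def)

text \<open>The first two components depend on (t, x) alone and are injective there, so no vertical
  tangent can occur and every graph is mapped to a graph, with an explicit domain and
  function.\<close>

lemma image_graph:
  assumes "graph_over D' f \<subseteq> \<Omega>"
  shows "\<Phi> ` graph_over D' f = graph_over (E0 \<inter> {r. (\<tau> r, \<xi> r) \<in> D'})
    (\<lambda>r. B r * (f (\<tau> r, \<xi> r) + h (\<tau> r, \<xi> r)))"
proof -
  have D': "den q \<noteq> 0" if "q \<in> D'" for q
  proof -
    have "(fst q, snd q, f q) \<in> \<Omega>" using assms that by (auto simp: graph_over_eq_image)
    then show ?thesis by (simp add: mem_\<Omega>)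
  qed
  have "\<Phi> ` graph_over D' f = (\<lambda>q. (fst (F q), snd (F q), \<mu> q * (f q + h q))) ` D'"
    unfolding graph_over_eq_image image_image \<Phi>_def heat_symmetry_form_eq ..
  also have "\<dots> = (\<lambda>r. (fst r, snd r, B r * (f (\<tau> r, \<xi> r) + h (\<tau> r, \<xi> r)))) ` (E0 \<inter> {r. (\<tau> r, \<xi> r) \<in> D'})"
  proof (intro set_eqI iffI; elim imageE)
    fix y q assume "y = (fst (F q), snd (F q), \<mu> q * (f q + h q))" "q \<in> D'"
    with F_image[OF D', of q] show "y \<in> (\<lambda>r. (fst r, snd r, B r * (f (\<tau> r, \<xi> r) + h (\<tau> r, \<xi> r)))) ` (E0 \<inter> {r. (\<tau> r, \<xi> r) \<in> D'})"
      by (intro image_eqI[of _ _ "F q"]) auto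
  next
    fix y r assume "y = (fst r, snd r, B r * (f (\<tau> r, \<xi> r) + h (\<tau> r, \<xi> r)))" "r \<in> E0 \<inter> {r. (\<tau> r, \<xi> r) \<in> D'}"
    with F_inverse[of r] F_image(5)[of "(\<tau> r, \<xi> r)"]
    show "y \<in> (\<lambda>q. (fst (F q), snd (F q), \<mu> q * (f q + h q))) ` D'"
      by (intro image_eqI[of _ _ "(\<tau> r, \<xi> r)"]) auto
  qed
  finally show ?thesis by (simp add: graph_over_eq_image)
qed

lemma image_graph_solution:
  assumes "heat_solution D' f" "graph_over D' f \<subseteq> \<Omega>"
  shows "heat_solution (E0 \<inter> {r. (\<tau> r, \<xi> r) \<in> D'}) (\<lambda>r. B r * (f (\<tau> r, \<xi> r) + h (\<tau> r, \<xi> r)))"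
proof -
  have "D' \<subseteq> D"
    using assms(2) by (force simp: graph_over_eq_image image_subset_iff mem_\<Omega>)
  then have "heat_solution D' h"
    using heat_solution_subset[OF h] assms(1) unfolding heat_solution_def[of D' f] by blast
  from transformed_heat_solution[OF heat_solution_add[OF assms(1) this]] show ?thesis .
qed

lemma point_transformation_form: "point_transformation \<Omega> \<Phi>"
proof -
  have D: "open D" and sh: "smooth_on D h" using h by (auto simp: heat_solution_def)
  have "\<Omega> = (\<lambda>p. (fst p, fst (snd p))) -` D \<inter> {p :: real \<times> real \<times> real. \<gamma> * fst p + \<delta> \<noteq> 0}"
    by (auto simp: \<Omega>_def)
  moreover have "open ((\<lambda>p :: real \<times> real \<times> real. (fst p, fst (snd p))) -` D)"
    by (intro open_vimage[OF D] continuous_intros)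
  moreover have "open {p :: real \<times> real \<times> real. \<gamma> * fst p + \<delta> \<noteq> 0}"
    by (intro open_Collect_neq continuous_intros)
  ultimately have \<Omega>: "open \<Omega>" by (simp only: open_Int)
  have nz: "\<gamma> * fst p + \<delta> \<noteq> 0" "(fst p, fst (snd p)) \<in> D" if "p \<in> \<Omega>" for p
    using that by (auto simp: \<Omega>_def)
  have nz4: "4 * (\<gamma> * fst p + \<delta>) \<noteq> 0" if "p \<in> \<Omega>" for p using nz[OF that] by simp
  have sh': "smooth_on \<Omega> (\<lambda>p. h (fst p, fst (snd p)))"
    by (intro smooth_on_compose[OF \<Omega> D sh] smooth_on_intros \<Omega> nz(2))
  have "smooth_on \<Omega> \<Phi>"
    unfolding \<Phi>_def heat_symmetry_form_def case_prod_beta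
    by (intro smooth_on_intros smooth_on_sqrt_abs smooth_on_exp \<Omega> nz(1) nz4 sh') auto
  moreover
  define W where "W = {(s, y, v :: real). (s, y) \<in> E0 \<and> (\<tau> (s, y), \<xi> (s, y)) \<in> D}"
  \<comment> \<open>The inverse: \<tau> and \<xi> recover the base point, and u is solved from v = B
    (u + h). \<open>W\<close> is the image of the domain, described through this inverse.\<close>
  define \<Psi> where "\<Psi> = (\<lambda>p. (\<tau> (fst p, fst (snd p)), \<xi> (fst p, fst (snd p)),
    snd (snd p) / B (fst p, fst (snd p)) - h (\<tau> (fst p, fst (snd p)), \<xi> (fst p, fst (snd p)))))"
  have inv: "\<Psi> (\<Phi> p) = p" "\<Phi> p \<in> W" if "p \<in> \<Omega>" for p
  proof -
    define q where "q = (fst p, fst (snd p))"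
    have p: "p = (fst q, snd q, snd (snd p))" by (simp add: q_def)
    have q: "den q \<noteq> 0" "q \<in> D" using nz[OF that] by (simp_all add: den_def q_def)
    have \<Phi>p: "\<Phi> p = (fst (F q), snd (F q), \<mu> q * (snd (snd p) + h q))"
      unfolding \<Phi>_def by (subst p) (rule heat_symmetry_form_eq)
    show "\<Phi> p \<in> W" using F_image[OF q(1)] q(2) by (simp add: \<Phi>p W_def)
    have "\<mu> q \<noteq> 0" using B_nonzero[OF F_image(1)[OF q(1)]] F_image(5)[OF q(1)] by simp
    then show "\<Psi> (\<Phi> p) = p"
      using F_image[OF q(1)] by (simp add: \<Phi>p \<Psi>_def) (metis p)
  qed
  have "W \<subseteq> \<Phi> ` \<Omega>"
  proof
    fix p assume pW: "p \<in> W"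
    define r where "r = (fst p, fst (snd p))"
    have p: "p = (fst r, snd r, snd (snd p))" by (simp add: r_def)
    have r: "r \<in> E0" "(\<tau> r, \<xi> r) \<in> D" using pW by (auto simp: W_def r_def)
    note i = F_inverse[OF r(1)]
    have "B r = \<mu> (\<tau> r, \<xi> r)" using F_image(5)[OF i(1)] i(2) by simp
    then have "\<Phi> (\<tau> r, \<xi> r, snd (snd p) / B r - h (\<tau> r, \<xi> r)) = p"
      using heat_symmetry_form_eq[of h "(\<tau> r, \<xi> r)" "snd (snd p) / B r - h (\<tau> r, \<xi> r)"] i(2) B_nonzero[OF r(1)]
      by (simp add: \<Phi>_def) (metis p)
    moreover have "(\<tau> r, \<xi> r, snd (snd p) / B r - h (\<tau> r, \<xi> r)) \<in> \<Omega>"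
      using mem_\<Omega>[of "(\<tau> r, \<xi> r)"] r(2) i(1) by simp
    ultimately show "p \<in> \<Phi> ` \<Omega>" by (metis image_eqI)
  qed
  then have W: "\<Phi> ` \<Omega> = W" using inv(2) by blast
  define E where "E = E0 \<inter> {r. (\<tau> r, \<xi> r) \<in> D}"
  have E: "open E" "E \<subseteq> E0"
    using transformed_heat_solution[OF h] by (auto simp: heat_solution_def E_def)
  have "W = (\<lambda>p. (fst p, fst (snd p))) -` E" by (auto simp: W_def E_def)
  then have oW: "open W" by (simp add: E(1) open_vimage continuous_intros)
  have WE: "(fst p, fst (snd p)) \<in> E" "(\<tau> (fst p, fst (snd p)), \<xi> (fst p, fst (snd p))) \<in> D" if "p \<in> W" for p
    using that by (auto simp: W_def E_def)
  have B: "B (fst p, fst (snd p)) \<noteq> 0" if "p \<in> W" for p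
    using WE(1)[OF that] E(2) B_nonzero by blast
  have sE: "smooth_on W (\<lambda>p. k (fst p, fst (snd p)))" if "smooth_on E0 k" for k :: "real \<times> real \<Rightarrow> real"
    by (intro smooth_on_compose[OF oW E(1) smooth_on_subset[OF that E(2)]] smooth_on_intros oW WE(1))
  have "smooth_on W \<Psi>"
    unfolding \<Psi>_def
    by (intro smooth_on_intros smooth_on_compose[OF oW D sh] oW sE smooth_\<tau> smooth_\<xi> smooth_B B WE(2))
  ultimately show ?thesis
    using \<Omega> oW inv(1) unfolding point_transformation_def W by blast
qed

text \<open>A graph determines its domain and its function there, so any E and g whose graph is the
  image coincide with the explicit transformed solution.\<close>

lemma heat_point_symmetry_form: "heat_point_symmetry \<Omega> \<Phi>"
  unfolding heat_point_symmetry_def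
proof (intro conjI point_transformation_form allI impI; elim conjE)
  fix D' f E g
  assume *: "heat_solution D' f" "graph_over D' f \<subseteq> \<Omega>" "\<Phi> ` graph_over D' f = graph_over E g"
  note eq = graph_over_eqD[OF trans[OF image_graph[OF *(2), symmetric] *(3)]]
  show "heat_solution E g"
    using heat_solution_cong[OF image_graph_solution[OF *(1,2)] eq(2)] unfolding eq(1) .
qed

end

end

section \<open>The symmetry pseudogroup\<close>

theorem theorem2:
  shows
    "(\<forall>\<Omega> \<Phi>. heat_point_symmetry \<Omega> \<Phi> \<longrightarrow>
        (\<forall>p\<in>\<Omega>. \<exists>N \<alpha> \<beta> \<gamma> \<delta> l1 l0 \<sigma> D h.
            open N \<and> p \<in> N \<and> N \<subseteq> \<Omega> \<and>
            \<alpha> * \<delta> - \<beta> * \<gamma> = 1 \<and> \<sigma> \<noteq> 0 \<and> heat_solution D h \<and>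
            (\<forall>(t, x, u)\<in>N. (t, x) \<in> D \<and> \<gamma> * t + \<delta> \<noteq> 0 \<and>
               \<Phi> (t, x, u) = heat_symmetry_form \<alpha> \<beta> \<gamma> \<delta> l1 l0 \<sigma> h (t, x, u)))) \<and>
     (\<forall>\<alpha> \<beta> \<gamma> \<delta> l1 l0 \<sigma> D h \<Omega> \<Phi>.
        \<alpha> * \<delta> - \<beta> * \<gamma> = 1 \<and> \<sigma> \<noteq> 0 \<and> heat_solution D h \<and>
        \<Omega> = {(t, x, u). (t, x) \<in> D \<and> \<gamma> * t + \<delta> \<noteq> 0} \<and>
        \<Phi> = heat_symmetry_form \<alpha> \<beta> \<gamma> \<delta> l1 l0 \<sigma> h \<longrightarrow>
        heat_point_symmetry \<Omega> \<Phi> \<and>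
        (\<forall>D' f. heat_solution D' f \<and> graph_over D' f \<subseteq> \<Omega> \<longrightarrow>
           (\<exists>E g. heat_solution E g \<and> \<Phi> ` graph_over D' f = graph_over E g)))"
proof (intro conjI allI impI ballI)
  fix \<Omega> \<Phi> p
  assume sym: "heat_point_symmetry \<Omega> \<Phi>" and p: "p \<in> \<Omega>"
  interpret heat_symmetry \<Omega> "\<lambda>p. fst (\<Phi> p)" "\<lambda>p. fst (snd (\<Phi> p))" "\<lambda>p. snd (snd (\<Phi> p))"
    by unfold_locales (use sym in simp)
  show "\<exists>N \<alpha> \<beta> \<gamma> \<delta> l1 l0 \<sigma> D h.
            open N \<and> p \<in> N \<and> N \<subseteq> \<Omega> \<and>
            \<alpha> * \<delta> - \<beta> * \<gamma> = 1 \<and> \<sigma> \<noteq> 0 \<and> heat_solution D h \<and>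
            (\<forall>(t, x, u)\<in>N. (t, x) \<in> D \<and> \<gamma> * t + \<delta> \<noteq> 0 \<and>
               \<Phi> (t, x, u) = heat_symmetry_form \<alpha> \<beta> \<gamma> \<delta> l1 l0 \<sigma> h (t, x, u))"
    using local_form[OF p] by simp
next
  fix \<alpha> \<beta> \<gamma> \<delta> l1 l0 \<sigma> D h \<Phi> and \<Omega> :: "(real \<times> real \<times> real) set"
  assume *: "\<alpha> * \<delta> - \<beta> * \<gamma> = 1 \<and> \<sigma> \<noteq> 0 \<and> heat_solution D h \<and>
        \<Omega> = {(t, x, u). (t, x) \<in> D \<and> \<gamma> * t + \<delta> \<noteq> 0} \<and>
        \<Phi> = heat_symmetry_form \<alpha> \<beta> \<gamma> \<delta> l1 l0 \<sigma> h"
  then interpret heat_form \<alpha> \<beta> \<gamma> \<delta> l1 l0 \<sigma> by unfold_locales simp_all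
  from * have h: "heat_solution D h" and eq: "\<Omega> = {(t, x, u). (t, x) \<in> D \<and> \<gamma> * t + \<delta> \<noteq> 0}"
    "\<Phi> = heat_symmetry_form \<alpha> \<beta> \<gamma> \<delta> l1 l0 \<sigma> h" by simp_all
  show "heat_point_symmetry \<Omega> \<Phi>"
    unfolding eq by (rule heat_point_symmetry_form[OF h])
  fix D' f
  assume f: "heat_solution D' f \<and> graph_over D' f \<subseteq> \<Omega>"
  \<comment> \<open>This complements the implication defining a symmetry, which speaks only of
    images that are graphs: for these transformations every image of a solution graph is
    one.\<close>
  then show "\<exists>E g. heat_solution E g \<and> \<Phi> ` graph_over D' f = graph_over E g"
    using image_graph[OF h] image_graph_solution[OF h] unfolding eq by blast
qed

end
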